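(* Let $(U,\xi)$ be a closed contact manifold of dimension $2n-1$ with $\xi$ cooriented, let $L$ be a closed $n$-dimensional manifold, and let $\varphi:L\to U$ be a pre-Lagrangian embedding. Then for every contact form $\lambda$ with $\ker\lambda=\xi$ for which $\varphi^*\lambda$ is closed, one has $[\varphi^*\lambda]\neq 0$ in $H^1(L;\mathbb{R})$. In particular, $H^1(L;\mathbb{R})\neq 0$.
   Context: Manifolds are smooth and nonempty; closed means compact without boundary. A contact structure on a $(2n-1)$-dimensional manifold $U$ is a codimension-one tangent distribution $\xi$ that is locally $\ker\lambda$ with $\lambda\wedge(d\lambda)^{n-1}\neq 0$. It is assumed coorientable with a fixed coorientation, so $\xi=\ker\lambda$ for a global 1-form $\lambda$ (a contact form), determined up to multiplication by a positive function. An $n$-dimensional submanifold $L\subset U$ is pre-Lagrangian if (a) $L$ is transverse to $\xi$, and (b) the distribution $\xi\cap TL$ on $L$ is integrable and can be defined by a closed 1-form (i.e. it is the kernel of a closed 1-form on $L$). An embedding $\varphi:L\to U$ is pre-Lagrangian if its image is a pre-Lagrangian submanifold. For a closed pre-Lagrangian submanifold there always exists a contact form $\lambda$ defining $\xi$ whose restriction to the submanifold is closed. *)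

theory Defs
  imports "HOL-Analysis.Analysis" "HOL-Combinatorics.Permutations" "HOL-Algebra.Coset"
begin

section \<open>Smooth functions on open subsets of Euclidean spaces\<close>

text \<open>The predicates below are only ever used on open sets \<open>S\<close>. A function is \<open>C\<^sup>k\<^sup>+\<^sup>1\<close> if it is
  differentiable and all its directional derivatives are \<open>C\<^sup>k\<close>.\<close>

fun Ck_on :: "nat \<Rightarrow> 'e set \<Rightarrow> ('e::euclidean_space \<Rightarrow> 'f::real_normed_vector) \<Rightarrow> bool" where
  "Ck_on 0 S f \<longleftrightarrow> continuous_on S f"
| "Ck_on (Suc k) S f \<longleftrightarrow> (\<forall>x\<in>S. f differentiable (at x)) \<and>
     (\<forall>w. Ck_on k S (\<lambda>x. frechet_derivative f (at x) w))"

definition smooth_on :: "'e set \<Rightarrow> ('e::euclidean_space \<Rightarrow> 'f::real_normed_vector) \<Rightarrow> bool" where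
  "smooth_on S f \<longleftrightarrow> (\<forall>k. Ck_on k S f)"

section \<open>Smooth manifolds\<close>

text \<open>A chart is a pair of its domain and its coordinate map; the values of the map off the
  domain are irrelevant. The dimension of the manifold is the dimension of the model space
  \<open>'e\<close>. Atlases need not be maximal.\<close>

type_synonym ('a, 'e) chart = "'a set \<times> ('a \<Rightarrow> 'e)"

record ('a, 'e) manifold =
  mtop :: "'a topology"
  atlas :: "('a, 'e) chart set"

abbreviation points :: "('a, 'e) manifold \<Rightarrow> 'a set" where
  "points M \<equiv> topspace (mtop M)"

abbreviation chart_dom :: "('a, 'e) chart \<Rightarrow> 'a set" where
  "chart_dom \<kappa> \<equiv> fst \<kappa>"

definition param :: "('a, 'e) chart \<Rightarrow> 'e \<Rightarrow> 'a" where
  "param \<kappa> = inv_into (chart_dom \<kappa>) (snd \<kappa>)"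

definition is_chart :: "'a topology \<Rightarrow> ('a, 'e::euclidean_space) chart \<Rightarrow> bool" where
  "is_chart X \<kappa> \<longleftrightarrow> openin X (chart_dom \<kappa>) \<and> open (snd \<kappa> ` chart_dom \<kappa>) \<and>
     homeomorphic_map (subtopology X (chart_dom \<kappa>)) (top_of_set (snd \<kappa> ` chart_dom \<kappa>)) (snd \<kappa>)"

definition smooth_transition ::
    "('a, 'e::euclidean_space) chart \<Rightarrow> ('a, 'e) chart \<Rightarrow> bool" where
  "smooth_transition \<kappa> \<theta> \<longleftrightarrow> smooth_on (snd \<kappa> ` (chart_dom \<kappa> \<inter> chart_dom \<theta>)) (snd \<theta> \<circ> param \<kappa>)"

definition smooth_manifold :: "('a, 'e::euclidean_space) manifold \<Rightarrow> bool" where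
  "smooth_manifold M \<longleftrightarrow>
     points M \<noteq> {} \<and> Hausdorff_space (mtop M) \<and> second_countable (mtop M) \<and>
     (\<forall>\<kappa>\<in>atlas M. is_chart (mtop M) \<kappa>) \<and> (\<Union>\<kappa>\<in>atlas M. chart_dom \<kappa>) = points M \<and>
     (\<forall>\<kappa>\<in>atlas M. \<forall>\<theta>\<in>atlas M. smooth_transition \<kappa> \<theta>)"

text \<open>Charts have open images in the model space, so these manifolds have no boundary.\<close>

definition closed_manifold :: "('a, 'e::euclidean_space) manifold \<Rightarrow> bool" where
  "closed_manifold M \<longleftrightarrow> smooth_manifold M \<and> compact_space (mtop M)"

text \<open>Membership in the maximal atlas generated by the given one.\<close>

definition smooth_chart ::
    "('a, 'e::euclidean_space) manifold \<Rightarrow> ('a, 'e) chart \<Rightarrow> bool" where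
  "smooth_chart M \<theta> \<longleftrightarrow> is_chart (mtop M) \<theta> \<and>
     (\<forall>\<kappa>\<in>atlas M. smooth_transition \<kappa> \<theta> \<and> smooth_transition \<theta> \<kappa>)"

section \<open>Tangent vectors and differentials\<close>

definition charts_at :: "('a, 'e) manifold \<Rightarrow> 'a \<Rightarrow> ('a, 'e) chart set" where
  "charts_at M p = {\<kappa>\<in>atlas M. p \<in> chart_dom \<kappa>}"

text \<open>An arbitrary chart of the atlas around \<open>p\<close>. Everything defined through it below does not
  depend on the choice, by the transformation law for tangent vectors and the chain rule.\<close>

definition chart_at :: "('a, 'e) manifold \<Rightarrow> 'a \<Rightarrow> ('a, 'e) chart" where
  "chart_at M p = (SOME \<kappa>. \<kappa> \<in> charts_at M p)"

text \<open>A tangent vector at \<open>p\<close> is the family of its coordinate vectors in all charts of the atlas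
  around \<open>p\<close>, subject to the transformation law; the value \<open>0\<close> at all other charts makes the
  representation unique. The vector space operations are pointwise.\<close>

type_synonym ('a, 'e) tangent = "('a, 'e) chart \<Rightarrow> 'e"

definition tangent_space ::
    "('a, 'e::euclidean_space) manifold \<Rightarrow> 'a \<Rightarrow> ('a, 'e) tangent set" where
  "tangent_space M p = {v.
     (\<forall>\<kappa>. \<kappa> \<notin> charts_at M p \<longrightarrow> v \<kappa> = 0) \<and>
     (\<forall>\<kappa>\<in>charts_at M p. \<forall>\<theta>\<in>charts_at M p.
        v \<theta> = frechet_derivative (snd \<theta> \<circ> param \<kappa>) (at (snd \<kappa> p)) (v \<kappa>))}"

text \<open>The tangent vector at \<open>p\<close> with coordinate vector \<open>w\<close> in the chart \<open>\<kappa>\<close>.\<close>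

definition tangent_of ::
    "('a, 'e::euclidean_space) manifold \<Rightarrow> ('a, 'e) chart \<Rightarrow> 'a \<Rightarrow> 'e \<Rightarrow> ('a, 'e) tangent" where
  "tangent_of M \<kappa> p w = (\<lambda>\<theta>. if \<theta> \<in> charts_at M p
     then frechet_derivative (snd \<theta> \<circ> param \<kappa>) (at (snd \<kappa> p)) w else 0)"

text \<open>The coordinate vector of \<open>v\<close> in a chart \<open>\<theta>\<close> that need not belong to the atlas.\<close>

definition coords ::
    "('a, 'e::euclidean_space) manifold \<Rightarrow> ('a, 'e) chart \<Rightarrow> 'a \<Rightarrow> ('a, 'e) tangent \<Rightarrow> 'e" where
  "coords M \<theta> p v =
     (let \<kappa> = chart_at M p in frechet_derivative (snd \<theta> \<circ> param \<kappa>) (at (snd \<kappa> p)) (v \<kappa>))"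

definition smooth_map ::
    "('a, 'e::euclidean_space) manifold \<Rightarrow> ('b, 'f::euclidean_space) manifold \<Rightarrow> ('a \<Rightarrow> 'b) \<Rightarrow> bool"
  where
  "smooth_map M N f \<longleftrightarrow> continuous_map (mtop M) (mtop N) f \<and>
     (\<forall>\<kappa>\<in>atlas M. \<forall>\<theta>\<in>atlas N.
        smooth_on (snd \<kappa> ` (chart_dom \<kappa> \<inter> f -` chart_dom \<theta>)) (snd \<theta> \<circ> f \<circ> param \<kappa>))"

definition differential ::
    "('a, 'e::euclidean_space) manifold \<Rightarrow> ('b, 'f::euclidean_space) manifold \<Rightarrow> ('a \<Rightarrow> 'b) \<Rightarrow>
     'a \<Rightarrow> ('a, 'e) tangent \<Rightarrow> ('b, 'f) tangent" where
  "differential M N f p v = (\<lambda>\<theta>. if \<theta> \<in> charts_at N (f p)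
     then (let \<kappa> = chart_at M p in
       frechet_derivative (snd \<theta> \<circ> f \<circ> param \<kappa>) (at (snd \<kappa> p)) (v \<kappa>))
     else 0)"

definition smooth_embedding ::
    "('a, 'e::euclidean_space) manifold \<Rightarrow> ('b, 'f::euclidean_space) manifold \<Rightarrow> ('a \<Rightarrow> 'b) \<Rightarrow> bool"
  where
  "smooth_embedding M N f \<longleftrightarrow> smooth_map M N f \<and> embedding_map (mtop M) (mtop N) f \<and>
     (\<forall>p\<in>points M. inj_on (differential M N f p) (tangent_space M p))"

definition submanifold ::
    "('a, 'e::euclidean_space) manifold \<Rightarrow> ('a, 'f::euclidean_space) manifold \<Rightarrow> bool" where
  "submanifold S M \<longleftrightarrow> smooth_manifold S \<and> points S \<subseteq> points M \<and> smooth_embedding S M id"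

text \<open>The image of an embedding \<open>f\<close> of \<open>M\<close> into \<open>N\<close>, with the subspace topology and the smooth
  structure for which \<open>f\<close> is a diffeomorphism onto its image.\<close>

definition image_manifold ::
    "('a, 'e) manifold \<Rightarrow> ('b, 'f) manifold \<Rightarrow> ('a \<Rightarrow> 'b) \<Rightarrow> ('b, 'e) manifold" where
  "image_manifold M N f =
     \<lparr>mtop = subtopology (mtop N) (f ` points M),
      atlas = (\<lambda>\<kappa>. (f ` chart_dom \<kappa>, snd \<kappa> \<circ> inv_into (points M) f)) ` atlas M\<rparr>"

section \<open>Differential 1-forms\<close>

type_synonym ('a, 'e) form1 = "'a \<Rightarrow> ('a, 'e) tangent \<Rightarrow> real"

text \<open>The coefficient, in the chart \<open>\<kappa>\<close>, of the form \<open>\<alpha>\<close> on the constant vector field \<open>w\<close>.\<close>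

definition local_rep ::
    "('a, 'e::euclidean_space) manifold \<Rightarrow> ('a, 'e) chart \<Rightarrow> ('a, 'e) form1 \<Rightarrow> 'e \<Rightarrow> 'e \<Rightarrow> real"
  where
  "local_rep M \<kappa> \<alpha> w x = \<alpha> (param \<kappa> x) (tangent_of M \<kappa> (param \<kappa> x) w)"

text \<open>Smooth 1-forms on an open subset \<open>W\<close>; the value \<open>0\<close> off the tangent spaces over \<open>W\<close> makes
  the representation unique.\<close>

definition one_form_on ::
    "('a, 'e::euclidean_space) manifold \<Rightarrow> 'a set \<Rightarrow> ('a, 'e) form1 \<Rightarrow> bool" where
  "one_form_on M W \<alpha> \<longleftrightarrow>
     (\<forall>p v. p \<notin> W \<or> v \<notin> tangent_space M p \<longrightarrow> \<alpha> p v = 0) \<and>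
     (\<forall>p\<in>W. \<forall>v\<in>tangent_space M p. \<forall>w\<in>tangent_space M p. \<forall>a b.
        \<alpha> p (\<lambda>\<kappa>. a *\<^sub>R v \<kappa> + b *\<^sub>R w \<kappa>) = a * \<alpha> p v + b * \<alpha> p w) \<and>
     (\<forall>\<kappa>\<in>atlas M. \<forall>w. smooth_on (snd \<kappa> ` (chart_dom \<kappa> \<inter> W)) (local_rep M \<kappa> \<alpha> w))"

abbreviation one_form :: "('a, 'e::euclidean_space) manifold \<Rightarrow> ('a, 'e) form1 \<Rightarrow> bool" where
  "one_form M \<equiv> one_form_on M (points M)"

definition form_kernel ::
    "('a, 'e::euclidean_space) manifold \<Rightarrow> ('a, 'e) form1 \<Rightarrow> 'a \<Rightarrow> ('a, 'e) tangent set" where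
  "form_kernel M \<alpha> p = {v\<in>tangent_space M p. \<alpha> p v = 0}"

definition pullback ::
    "('a, 'e::euclidean_space) manifold \<Rightarrow> ('b, 'f::euclidean_space) manifold \<Rightarrow> ('a \<Rightarrow> 'b) \<Rightarrow>
     ('b, 'f) form1 \<Rightarrow> ('a, 'e) form1" where
  "pullback M N f \<beta> = (\<lambda>p v. if p \<in> points M \<and> v \<in> tangent_space M p
     then \<beta> (f p) (differential M N f p v) else 0)"

text \<open>In coordinates, \<open>d\<alpha>(v, w) = v(\<alpha>(w)) - w(\<alpha>(v))\<close> with \<open>v\<close> and \<open>w\<close> extended to constant
  vector fields, whose Lie bracket vanishes.\<close>

definition ext_deriv ::
    "('a, 'e::euclidean_space) manifold \<Rightarrow> ('a, 'e) form1 \<Rightarrow>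
     'a \<Rightarrow> ('a, 'e) tangent \<Rightarrow> ('a, 'e) tangent \<Rightarrow> real" where
  "ext_deriv M \<alpha> p v w = (let \<kappa> = chart_at M p in
     frechet_derivative (local_rep M \<kappa> \<alpha> (w \<kappa>)) (at (snd \<kappa> p)) (v \<kappa>) -
     frechet_derivative (local_rep M \<kappa> \<alpha> (v \<kappa>)) (at (snd \<kappa> p)) (w \<kappa>))"

definition closed_form :: "('a, 'e::euclidean_space) manifold \<Rightarrow> ('a, 'e) form1 \<Rightarrow> bool" where
  "closed_form M \<alpha> \<longleftrightarrow> (\<forall>p\<in>points M. \<forall>v\<in>tangent_space M p. \<forall>w\<in>tangent_space M p.
     ext_deriv M \<alpha> p v w = 0)"

section \<open>First de Rham cohomology\<close>

definition smooth_function :: "('a, 'e::euclidean_space) manifold \<Rightarrow> ('a \<Rightarrow> real) \<Rightarrow> bool" where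
  "smooth_function M f \<longleftrightarrow> (\<forall>\<kappa>\<in>atlas M. smooth_on (snd \<kappa> ` chart_dom \<kappa>) (f \<circ> param \<kappa>))"

definition fun_differential ::
    "('a, 'e::euclidean_space) manifold \<Rightarrow> ('a \<Rightarrow> real) \<Rightarrow> ('a, 'e) form1" where
  "fun_differential M f = (\<lambda>p v. if p \<in> points M \<and> v \<in> tangent_space M p
     then (let \<kappa> = chart_at M p in frechet_derivative (f \<circ> param \<kappa>) (at (snd \<kappa> p)) (v \<kappa>))
     else 0)"

text \<open>Closed 1-forms under pointwise addition, written in the multiplicative record notation of
  the group library.\<close>

definition closed_forms :: "('a, 'e::euclidean_space) manifold \<Rightarrow> ('a, 'e) form1 monoid" where
  "closed_forms M = \<lparr>carrier = {\<alpha>. one_form M \<alpha> \<and> closed_form M \<alpha>},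
     mult = (\<lambda>\<alpha> \<beta> p v. \<alpha> p v + \<beta> p v), one = (\<lambda>p v. 0)\<rparr>"

definition exact_forms :: "('a, 'e::euclidean_space) manifold \<Rightarrow> ('a, 'e) form1 set" where
  "exact_forms M = {fun_differential M f | f. smooth_function M f}"

text \<open>\<open>H\<^sup>1(M; \<real>)\<close>; its zero element is \<open>\<one>\<close>.\<close>

definition deRham_H1 :: "('a, 'e::euclidean_space) manifold \<Rightarrow> ('a, 'e) form1 set monoid" where
  "deRham_H1 M = closed_forms M Mod exact_forms M"

definition deRham_class ::
    "('a, 'e::euclidean_space) manifold \<Rightarrow> ('a, 'e) form1 \<Rightarrow> ('a, 'e) form1 set" where
  "deRham_class M \<alpha> = exact_forms M #>\<^bsub>closed_forms M\<^esub> \<alpha>"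

section \<open>Contact structures\<close>

text \<open>Alternating \<open>k\<close>-linear forms on a vector space are represented as functions of sequences of
  vectors that only depend on the first \<open>k\<close> entries.\<close>

definition wedge ::
    "nat \<Rightarrow> nat \<Rightarrow> ((nat \<Rightarrow> 'v) \<Rightarrow> real) \<Rightarrow> ((nat \<Rightarrow> 'v) \<Rightarrow> real) \<Rightarrow> (nat \<Rightarrow> 'v) \<Rightarrow> real" where
  "wedge k l a b v =
     (\<Sum>\<sigma> | \<sigma> permutes {..<k + l}.
        of_int (sign \<sigma>) * a (\<lambda>i. v (\<sigma> i)) * b (\<lambda>i. v (\<sigma> (k + i)))) / (fact k * fact l)"

fun wedge_power :: "nat \<Rightarrow> ((nat \<Rightarrow> 'v) \<Rightarrow> real) \<Rightarrow> nat \<Rightarrow> (nat \<Rightarrow> 'v) \<Rightarrow> real" where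
  "wedge_power k a 0 = (\<lambda>v. 1)"
| "wedge_power k a (Suc m) = wedge k (k * m) a (wedge_power k a m)"

text \<open>The form \<open>\<alpha> \<and> (d\<alpha>)\<^sup>n\<^sup>-\<^sup>1\<close> at the point \<open>p\<close>.\<close>

definition contact_volume ::
    "nat \<Rightarrow> ('a, 'e::euclidean_space) manifold \<Rightarrow> ('a, 'e) form1 \<Rightarrow>
     'a \<Rightarrow> (nat \<Rightarrow> ('a, 'e) tangent) \<Rightarrow> real" where
  "contact_volume n M \<alpha> p =
     wedge 1 (2 * (n - 1)) (\<lambda>v. \<alpha> p (v 0))
       (wedge_power 2 (\<lambda>v. ext_deriv M \<alpha> p (v 0) (v 1)) (n - 1))"

text \<open>Contact forms on an open subset \<open>W\<close> of a manifold of dimension \<open>2n - 1\<close>.\<close>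

definition contact_form_on ::
    "nat \<Rightarrow> ('a, 'e::euclidean_space) manifold \<Rightarrow> 'a set \<Rightarrow> ('a, 'e) form1 \<Rightarrow> bool" where
  "contact_form_on n M W \<alpha> \<longleftrightarrow> one_form_on M W \<alpha> \<and>
     (\<forall>p\<in>W. \<exists>v. (\<forall>i<2 * n - 1. v i \<in> tangent_space M p) \<and> contact_volume n M \<alpha> p v \<noteq> 0)"

abbreviation contact_form ::
    "nat \<Rightarrow> ('a, 'e::euclidean_space) manifold \<Rightarrow> ('a, 'e) form1 \<Rightarrow> bool" where
  "contact_form n M \<equiv> contact_form_on n M (points M)"

text \<open>A tangent distribution is the family of its fibres. That it has codimension one follows
  from being locally the kernel of a contact form, which vanishes nowhere.\<close>

type_synonym ('a, 'e) distribution = "'a \<Rightarrow> ('a, 'e) tangent set"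

definition contact_structure ::
    "nat \<Rightarrow> ('a, 'e::euclidean_space) manifold \<Rightarrow> ('a, 'e) distribution \<Rightarrow> bool" where
  "contact_structure n M \<xi> \<longleftrightarrow> (\<forall>p\<in>points M. \<exists>W \<alpha>. openin (mtop M) W \<and> p \<in> W \<and>
     contact_form_on n M W \<alpha> \<and> (\<forall>q\<in>W. \<xi> q = form_kernel M \<alpha> q))"

text \<open>A coorientation of \<open>\<xi>\<close> is a continuous choice \<open>P\<close> of one of the two sides of \<open>\<xi>\<close> in each
  tangent space.\<close>

definition coorientation ::
    "('a, 'e::euclidean_space) manifold \<Rightarrow> ('a, 'e) distribution \<Rightarrow> ('a, 'e) distribution \<Rightarrow> bool"
  where
  "coorientation M \<xi> P \<longleftrightarrow> (\<forall>p\<in>points M. \<exists>W \<alpha>. openin (mtop M) W \<and> p \<in> W \<and>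
     one_form_on M W \<alpha> \<and>
     (\<forall>q\<in>W. \<xi> q = form_kernel M \<alpha> q \<and> P q = {v\<in>tangent_space M q. \<alpha> q v > 0}))"

section \<open>Pre-Lagrangian submanifolds\<close>

text \<open>Integrability in the sense of flat charts: around every point there are coordinates in
  which the distribution is a constant subspace.\<close>

definition integrable_distribution ::
    "('a, 'e::euclidean_space) manifold \<Rightarrow> ('a, 'e) distribution \<Rightarrow> bool" where
  "integrable_distribution M \<Delta> \<longleftrightarrow> (\<forall>p\<in>points M. \<exists>\<theta> V.
     smooth_chart M \<theta> \<and> p \<in> chart_dom \<theta> \<and> subspace V \<and>
     (\<forall>q\<in>chart_dom \<theta>. \<Delta> q = {v\<in>tangent_space M q. coords M \<theta> q v \<in> V}))"

text \<open>\<open>T\<^sub>qS\<close> is regarded as a subspace of \<open>T\<^sub>qM\<close> through the differential of the inclusion.\<close>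

definition transverse ::
    "('a, 'e::euclidean_space) manifold \<Rightarrow> ('a, 'f::euclidean_space) manifold \<Rightarrow>
     ('a, 'f) distribution \<Rightarrow> bool" where
  "transverse S M \<xi> \<longleftrightarrow> (\<forall>q\<in>points S.
     {(\<lambda>\<kappa>. differential S M id q u \<kappa> + x \<kappa>) | u x. u \<in> tangent_space S q \<and> x \<in> \<xi> q}
       = tangent_space M q)"

definition induced_distribution ::
    "('a, 'e::euclidean_space) manifold \<Rightarrow> ('a, 'f::euclidean_space) manifold \<Rightarrow>
     ('a, 'f) distribution \<Rightarrow> ('a, 'e) distribution" where
  "induced_distribution S M \<xi> q = {u\<in>tangent_space S q. differential S M id q u \<in> \<xi> q}"

definition pre_Lagrangian ::
    "('a, 'e::euclidean_space) manifold \<Rightarrow> ('a, 'f::euclidean_space) manifold \<Rightarrow>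
     ('a, 'f) distribution \<Rightarrow> bool" where
  "pre_Lagrangian S M \<xi> \<longleftrightarrow> submanifold S M \<and> transverse S M \<xi> \<and>
     integrable_distribution S (induced_distribution S M \<xi>) \<and>
     (\<exists>\<alpha>. one_form S \<alpha> \<and> closed_form S \<alpha> \<and>
        (\<forall>q\<in>points S. induced_distribution S M \<xi> q = form_kernel S \<alpha> q))"

definition pre_Lagrangian_embedding ::
    "('b, 'e::euclidean_space) manifold \<Rightarrow> ('a, 'f::euclidean_space) manifold \<Rightarrow>
     ('a, 'f) distribution \<Rightarrow> ('b \<Rightarrow> 'a) \<Rightarrow> bool" where
  "pre_Lagrangian_embedding L M \<xi> \<phi> \<longleftrightarrow>
     smooth_embedding L M \<phi> \<and> pre_Lagrangian (image_manifold L M \<phi>) M \<xi>"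

end

theory Submission
  imports Defs
begin

text \<open>An exact form \<open>df\<close> on a closed manifold vanishes at a maximum of \<open>f\<close>. By transversality, a
  contact form defining \<open>\<xi>\<close> restricts to a nowhere vanishing form on the pre-Lagrangian submanifold,
  so the restriction is not exact. For \<open>H\<^sup>1(L; \<real>) \<noteq> 0\<close> no closed contact form is needed: the closed
  1-form on the image that cuts out \<open>\<xi>\<close> is nowhere zero for the same reason, and its pullback to
  \<open>L\<close> represents a nonzero class. That the pullback is closed requires the independence of \<open>d\<alpha>\<close> from
  the charts, which rests on the symmetry of second derivatives.\<close>

section \<open>Calculus\<close>

text \<open>The pre-Lagrangian conditions speak of the image manifold, the cohomology speaks of
  \<open>L\<close>. A tangent vector is a family of coordinates indexed by an atlas, and the two
  atlases differ, so their tangent vectors are different objects even at corresponding points. The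
  bridge is that the charts of the image are the charts of \<open>L\<close> carried along \<phi>: in
  corresponding charts \<phi> is the identity, vectors correspond when their coordinates agree, and
  a form and its pullback have the same coefficients. What obstructs this simple picture is that
  differentials and d\<alpha> are defined in the chart picked by \<open>chart_at\<close>, and the
  picks on the two manifolds are unrelated. Each such notion is therefore first shown to be
  computable in any chart of the atlas.\<close>

lemma frechet_derivative_cong_open:
  assumes "open X" "x \<in> X" "\<And>y. y \<in> X \<Longrightarrow> f y = g y"
  shows "frechet_derivative f (at x) = frechet_derivative g (at x)"
proof -
  \<comment> \<open>\<open>frechet_derivative\<close> is a Hilbert choice, so it suffices that
    \<open>f\<close> and \<open>g\<close> have the same derivatives at \<open>x\<close>. This covers
    points where there is none.\<close>
  have "(f has_derivative D) (at x) \<longleftrightarrow> (g has_derivative D) (at x)" for D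
    using assms has_derivative_transform_within_open by metis
  then show ?thesis
    by (simp add: frechet_derivative_def)
qed

lemma differentiable_cong_open:
  assumes "open X" "x \<in> X" "\<And>y. y \<in> X \<Longrightarrow> f y = g y"
  shows "f differentiable (at x) \<longleftrightarrow> g differentiable (at x)"
  using assms has_derivative_transform_within_open unfolding differentiable_def by metis

text \<open>On an open set, agreement of two functions passes to their directional derivatives,
  which are again compared on the same set; hence the induction over both functions.\<close>

lemma Ck_on_cong_open:
  assumes "open S" "\<And>x. x \<in> S \<Longrightarrow> f x = g x"
  shows "Ck_on k S f \<longleftrightarrow> Ck_on k S g"
  using assms(2)
proof (induction k arbitrary: f g)
  case 0
  then show ?case
    by (metis Ck_on.simps(1) continuous_on_cong)
next
  case (Suc k)
  have "Ck_on k S (\<lambda>x. frechet_derivative f (at x) w) \<longleftrightarrow>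
      Ck_on k S (\<lambda>x. frechet_derivative g (at x) w)" for w
  proof (rule Suc.IH)
    show "frechet_derivative f (at x) w = frechet_derivative g (at x) w" if "x \<in> S" for x
      using frechet_derivative_cong_open[OF assms(1) that Suc.prems] by simp
  qed
  moreover have "f differentiable (at x) \<longleftrightarrow> g differentiable (at x)" if "x \<in> S" for x
    using differentiable_cong_open[OF assms(1) that Suc.prems] .
  ultimately show ?case
    by simp
qed

lemma smooth_on_cong_open:
  assumes "open S" "\<And>x. x \<in> S \<Longrightarrow> f x = g x"
  shows "smooth_on S f \<longleftrightarrow> smooth_on S g"
  using Ck_on_cong_open[OF assms] by (simp add: smooth_on_def)

lemma smooth_on_imp_differentiable:
  assumes "smooth_on S f" "x \<in> S"
  shows "f differentiable (at x)"
  using assms unfolding smooth_on_def by (metis Ck_on.simps(2))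

lemma smooth_on_has_derivative:
  "smooth_on S f \<Longrightarrow> x \<in> S \<Longrightarrow> (f has_derivative frechet_derivative f (at x)) (at x)"
  using smooth_on_imp_differentiable frechet_derivative_works by metis

lemma smooth_on_imp_continuous_on: "smooth_on S f \<Longrightarrow> continuous_on S f"
  unfolding smooth_on_def by (metis Ck_on.simps(1))

lemma smooth_on_const: "smooth_on S (\<lambda>x. c)"
proof -
  have "Ck_on k S (\<lambda>x. c)" for k and c :: 'b
    by (induction k arbitrary: c) auto
  then show ?thesis
    by (simp add: smooth_on_def)
qed

lemma smooth_on_frechet_derivative:
  "smooth_on S f \<Longrightarrow> smooth_on S (\<lambda>x. frechet_derivative f (at x) w)"
  unfolding smooth_on_def by (metis Ck_on.simps(2))

text \<open>Trades a dependence on a vector for finitely many scalar coefficients, so that the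
  product rule applies when vector and base point vary together.\<close>

lemma linear_comb_on_Basis:
  fixes f :: "'e::euclidean_space \<Rightarrow> real"
  assumes "\<And>a b v w. f (a *\<^sub>R v + b *\<^sub>R w) = a * f v + b * f w"
  shows "f v = (\<Sum>b\<in>Basis. (v \<bullet> b) * f b)"
proof -
  have "f (v + w) = f v + f w" "f (a *\<^sub>R v) = a *\<^sub>R f v" for a v w
    using assms[of 1 v 1 w] assms[of a v 0 v] by simp_all
  then have "linear f"
    by (simp add: linear_iff)
  then have "f (\<Sum>b\<in>Basis. (v \<bullet> b) *\<^sub>R b) = (\<Sum>b\<in>Basis. (v \<bullet> b) * f b)"
    by (simp add: linear_sum linear_cmul)
  then show ?thesis
    by (simp add: euclidean_representation)
qed

text \<open>The mean value theorem, applied once in each direction, to the second difference of \<open>f\<close>.\<close>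

lemma second_difference_mvt:
  fixes f :: "'e::real_normed_vector \<Rightarrow> real"
  assumes f: "\<And>y. y \<in> ball x d \<Longrightarrow> (f has_derivative f' y) (at y)"
    and g: "\<And>y. y \<in> ball x d \<Longrightarrow> ((\<lambda>z. f' z v) has_derivative g y) (at y)"
    and t: "0 < t" "t * (norm v + norm w) < d"
  obtains s r where "0 < s" "s < t" "0 < r" "r < t"
    "f (x + t *\<^sub>R v + t *\<^sub>R w) - f (x + t *\<^sub>R v) - f (x + t *\<^sub>R w) + f x =
       t * t * g (x + s *\<^sub>R v + r *\<^sub>R w) w"
proof -
  have inb: "x + s *\<^sub>R v + r *\<^sub>R w \<in> ball x d" if "0 \<le> s" "s \<le> t" "0 \<le> r" "r \<le> t" for s r
  proof -
    have "norm (s *\<^sub>R v + r *\<^sub>R w) \<le> s * norm v + r * norm w"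
      using norm_triangle_ineq[of "s *\<^sub>R v" "r *\<^sub>R w"] that by simp
    also have "\<dots> \<le> t * (norm v + norm w)"
      using that by (simp add: distrib_left add_mono mult_right_mono)
    finally have "norm (s *\<^sub>R v + r *\<^sub>R w) < d"
      using t by simp
    moreover have "dist x (x + s *\<^sub>R v + r *\<^sub>R w) = norm (s *\<^sub>R v + r *\<^sub>R w)"
      by (metis add.assoc dist_add_cancel dist_0_norm add.right_neutral)
    ultimately show ?thesis
      by simp
  qed
  have comm: "(\<lambda>h. h * c) = (*) c" for c :: real
    by (rule ext) simp
  have d1: "((\<lambda>s. f (x + s *\<^sub>R v + r *\<^sub>R w)) has_real_derivative f' (x + s *\<^sub>R v + r *\<^sub>R w) v) (at s)"
    if "0 \<le> s" "s \<le> t" "0 \<le> r" "r \<le> t" for s r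
  proof -
    have "((\<lambda>s. x + s *\<^sub>R v + r *\<^sub>R w) has_derivative (\<lambda>h. h *\<^sub>R v)) (at s)"
      by (auto intro!: derivative_eq_intros)
    from has_derivative_compose[OF this f[OF inb[OF that]]]
    show ?thesis
      using linear_cmul[OF has_derivative_linear[OF f[OF inb[OF that]]]]
      by (simp add: has_field_derivative_def comm)
  qed
  have d2: "((\<lambda>r. f' (x + s *\<^sub>R v + r *\<^sub>R w) v) has_real_derivative g (x + s *\<^sub>R v + r *\<^sub>R w) w) (at r)"
    if "0 \<le> s" "s \<le> t" "0 \<le> r" "r \<le> t" for s r
  proof -
    have "((\<lambda>r. x + s *\<^sub>R v + r *\<^sub>R w) has_derivative (\<lambda>h. h *\<^sub>R w)) (at r)"
      by (auto intro!: derivative_eq_intros)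
    from has_derivative_compose[OF this g[OF inb[OF that]]]
    show ?thesis
      using linear_cmul[OF has_derivative_linear[OF g[OF inb[OF that]]]]
      by (simp add: has_field_derivative_def comm)
  qed
  \<comment> \<open>The second difference is the increment over \<open>s\<close> of one function,
    the difference of \<open>f\<close> along the lines \<open>r = t\<close> and
    \<open>r = 0\<close>. The terms \<open>0 *\<^sub>R w\<close> are kept unsimplified so that
    \<open>d1\<close> matches them.\<close>
  have "\<exists>s>0. s < t \<and>
      (f (x + t *\<^sub>R v + t *\<^sub>R w) - f (x + t *\<^sub>R v + 0 *\<^sub>R w)) -
      (f (x + 0 *\<^sub>R v + t *\<^sub>R w) - f (x + 0 *\<^sub>R v + 0 *\<^sub>R w)) =
      (t - 0) * (f' (x + s *\<^sub>R v + t *\<^sub>R w) v - f' (x + s *\<^sub>R v + 0 *\<^sub>R w) v)"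
    using t(1) by (intro MVT2[of 0 t "\<lambda>s. f (x + s *\<^sub>R v + t *\<^sub>R w) - f (x + s *\<^sub>R v + 0 *\<^sub>R w)"])
      (auto intro!: DERIV_diff d1 simp del: scale_zero_left)
  then obtain s where s: "0 < s" "s < t"
      "f (x + t *\<^sub>R v + t *\<^sub>R w) - f (x + t *\<^sub>R v) - f (x + t *\<^sub>R w) + f x =
        t * (f' (x + s *\<^sub>R v + t *\<^sub>R w) v - f' (x + s *\<^sub>R v + 0 *\<^sub>R w) v)"
    by auto
  have "\<exists>r>0. r < t \<and> f' (x + s *\<^sub>R v + t *\<^sub>R w) v - f' (x + s *\<^sub>R v + 0 *\<^sub>R w) v =
      (t - 0) * g (x + s *\<^sub>R v + r *\<^sub>R w) w"
    using t(1) s by (intro MVT2) (auto intro!: d2 simp del: scale_zero_left)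
  then obtain r where "0 < r" "r < t" "f' (x + s *\<^sub>R v + t *\<^sub>R w) v - f' (x + s *\<^sub>R v + 0 *\<^sub>R w) v =
      t * g (x + s *\<^sub>R v + r *\<^sub>R w) w"
    by auto
  with s that[of s r] show ?thesis
    by (simp add: mult.assoc)
qed

text \<open>The second difference is symmetric in \<open>v\<close> and \<open>w\<close>. Divided by
  the square of \<open>t\<close> it is a value of either mixed derivative at a point near
  \<open>x\<close>, and both mixed derivatives are continuous at \<open>x\<close>.\<close>

lemma second_derivative_symmetric_real:
  fixes f :: "'e::real_normed_vector \<Rightarrow> real"
  assumes "open S" "x \<in> S"
    and f: "\<And>y. y \<in> S \<Longrightarrow> (f has_derivative f' y) (at y)"
    and g: "\<And>y. y \<in> S \<Longrightarrow> ((\<lambda>z. f' z v) has_derivative g y) (at y)"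
    and h: "\<And>y. y \<in> S \<Longrightarrow> ((\<lambda>z. f' z w) has_derivative h y) (at y)"
    and cg: "continuous_on S (\<lambda>y. g y w)" and ch: "continuous_on S (\<lambda>y. h y v)"
  shows "g x w = h x v"
proof (rule ccontr)
  assume ne: "g x w \<noteq> h x v"
  \<comment> \<open>Half the supposed gap: two errors below \<open>e\<close> cannot bridge
    it.\<close>
  define e where "e = \<bar>g x w - h x v\<bar> / 2"
  have e: "e > 0"
    using ne by (simp add: e_def)
  have "isCont (\<lambda>y. g y w) x" "isCont (\<lambda>y. h y v) x"
    using cg ch assms(1,2) continuous_on_eq_continuous_at by blast+
  then obtain d1 d2 where d1: "d1 > 0" "\<And>y. dist y x < d1 \<Longrightarrow> \<bar>g y w - g x w\<bar> < e"
    and d2: "d2 > 0" "\<And>y. dist y x < d2 \<Longrightarrow> \<bar>h y v - h x v\<bar> < e"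
    using e unfolding continuous_at_eps_delta dist_real_def by metis
  obtain d0 where d0: "d0 > 0" "ball x d0 \<subseteq> S"
    using assms(1,2) open_contains_ball by blast
  define d where "d = min d0 (min d1 d2)"
  have d: "d > 0" "d \<le> d0" "d \<le> d1" "d \<le> d2"
    using d0 d1 d2 by (auto simp: d_def)
  have sub: "y \<in> S" if "y \<in> ball x d" for y
    using that d d0 by auto
  \<comment> \<open>The summand 1 keeps the denominator positive when \<open>v\<close> and
    \<open>w\<close> are both zero.\<close>
  define t where "t = d / (2 * (norm v + norm w + 1))"
  have pos: "norm v + norm w + 1 > 0"
    by (simp add: add_nonneg_pos)
  have t: "t > 0"
    using d pos by (simp add: t_def)
  have "t * (norm v + norm w + 1) = d / 2"
    using pos by (simp add: t_def field_simps)
  then have td: "t * (norm v + norm w) < d"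
    using t d by (simp add: distrib_left)
  have near: "dist (x + s *\<^sub>R a + r *\<^sub>R b) x < d"
    if "0 < s" "s < t" "0 < r" "r < t" "t * (norm a + norm b) < d" for s r and a b :: 'e
  proof -
    have "norm (s *\<^sub>R a + r *\<^sub>R b) \<le> s * norm a + r * norm b"
      using norm_triangle_ineq[of "s *\<^sub>R a" "r *\<^sub>R b"] that by simp
    also have "\<dots> \<le> t * (norm a + norm b)"
      using that by (simp add: distrib_left add_mono mult_right_mono)
    finally have "norm (s *\<^sub>R a + r *\<^sub>R b) < d"
      using that by simp
    then show ?thesis
      by (simp add: dist_norm add.assoc)
  qed
  obtain s r where 1: "0 < s" "s < t" "0 < r" "r < t"
    "f (x + t *\<^sub>R v + t *\<^sub>R w) - f (x + t *\<^sub>R v) - f (x + t *\<^sub>R w) + f x =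
       t * t * g (x + s *\<^sub>R v + r *\<^sub>R w) w"
    using second_difference_mvt[where f=f and f'=f' and g=g and v=v and w=w, OF f g t td] sub by metis
  \<comment> \<open>The same second difference with \<open>v\<close> and \<open>w\<close> exchanged,
    which now produces the other mixed derivative.\<close>
  obtain s' r' where 2: "0 < s'" "s' < t" "0 < r'" "r' < t"
    "f (x + t *\<^sub>R w + t *\<^sub>R v) - f (x + t *\<^sub>R w) - f (x + t *\<^sub>R v) + f x =
       t * t * h (x + s' *\<^sub>R w + r' *\<^sub>R v) v"
    using second_difference_mvt[where f=f and f'=f' and g=h and v=w and w=v, OF f h t] td sub
    by (metis add.commute)
  have "t * t * g (x + s *\<^sub>R v + r *\<^sub>R w) w = t * t * h (x + s' *\<^sub>R w + r' *\<^sub>R v) v"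
    using 1(5) 2(5) by (simp add: algebra_simps)
  then have "g (x + s *\<^sub>R v + r *\<^sub>R w) w = h (x + s' *\<^sub>R w + r' *\<^sub>R v) v"
    using t by simp
  moreover have "\<bar>g (x + s *\<^sub>R v + r *\<^sub>R w) w - g x w\<bar> < e"
    using near[OF 1(1-4) td] d by (intro d1) simp
  moreover have "\<bar>h (x + s' *\<^sub>R w + r' *\<^sub>R v) v - h x v\<bar> < e"
    using near[OF 2(1-4), of w v] td d by (intro d2) (simp add: add.commute)
  ultimately have "\<bar>g x w - h x v\<bar> < 2 * e"
    by linarith
  then show False
    by (simp add: e_def)
qed

lemma second_derivative_symmetric:
  fixes f :: "'e::euclidean_space \<Rightarrow> 'f::euclidean_space"
  assumes "open S" "x \<in> S" "smooth_on S f"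
  shows "frechet_derivative (\<lambda>y. frechet_derivative f (at y) v) (at x) w =
         frechet_derivative (\<lambda>y. frechet_derivative f (at y) w) (at x) v"
proof (rule euclidean_eqI)
  fix b :: 'f
  let ?D = "\<lambda>v y. frechet_derivative f (at y) v"
  have 1: "((\<lambda>y. f y \<bullet> b) has_derivative (\<lambda>v. ?D v y \<bullet> b)) (at y)" if "y \<in> S" for y
    by (rule has_derivative_inner_left[OF smooth_on_has_derivative[OF assms(3) that]])
  have 2: "((\<lambda>y. ?D v y \<bullet> b) has_derivative (\<lambda>w. frechet_derivative (?D v) (at y) w \<bullet> b)) (at y)"
    if "y \<in> S" for y v
    by (rule has_derivative_inner_left[OF
          smooth_on_has_derivative[OF smooth_on_frechet_derivative[OF assms(3)] that]])
  have 3: "continuous_on S (\<lambda>y. frechet_derivative (?D v) (at y) w \<bullet> b)" for v w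
    by (intro continuous_intros smooth_on_imp_continuous_on smooth_on_frechet_derivative assms)
  show "frechet_derivative (?D v) (at x) w \<bullet> b = frechet_derivative (?D w) (at x) v \<bullet> b"
    using second_derivative_symmetric_real[OF assms(1,2) 1 2 2 3 3] .
qed

section \<open>Charts and tangent vectors\<close>

lemma smooth_manifold_chart: "smooth_manifold M \<Longrightarrow> \<kappa> \<in> atlas M \<Longrightarrow> is_chart (mtop M) \<kappa>"
  by (simp add: smooth_manifold_def)

lemma chart_dom_subset: "smooth_manifold M \<Longrightarrow> \<kappa> \<in> atlas M \<Longrightarrow> chart_dom \<kappa> \<subseteq> points M"
  using smooth_manifold_chart openin_subset unfolding is_chart_def by blast

lemma chart_inj_on:
  assumes "smooth_manifold M" "\<kappa> \<in> atlas M"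
  shows "inj_on (snd \<kappa>) (chart_dom \<kappa>)"
  using homeomorphic_imp_injective_map smooth_manifold_chart[OF assms] chart_dom_subset[OF assms]
  unfolding is_chart_def by (metis topspace_subtopology_subset)

lemma param_chart [simp]:
  "smooth_manifold M \<Longrightarrow> \<kappa> \<in> atlas M \<Longrightarrow> p \<in> chart_dom \<kappa> \<Longrightarrow> param \<kappa> (snd \<kappa> p) = p"
  by (simp add: param_def inv_into_f_f chart_inj_on)

lemma chart_image_open:
  assumes "smooth_manifold M" "\<kappa> \<in> atlas M" "openin (mtop M) W"
  shows "open (snd \<kappa> ` (chart_dom \<kappa> \<inter> W))"
proof -
  have "openin (subtopology (mtop M) (chart_dom \<kappa>)) (chart_dom \<kappa> \<inter> W)"
    using assms(3) by (simp add: openin_subtopology_Int2)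
  then have "openin (top_of_set (snd \<kappa> ` chart_dom \<kappa>)) (snd \<kappa> ` (chart_dom \<kappa> \<inter> W))"
    using smooth_manifold_chart[OF assms(1,2)] homeomorphic_imp_open_map
    unfolding is_chart_def open_map_def by blast
  then show ?thesis
    using smooth_manifold_chart[OF assms(1,2)] openin_open_trans unfolding is_chart_def by blast
qed

lemma charts_at_point:
  assumes "smooth_manifold M" "\<kappa> \<in> charts_at M p"
  shows "p \<in> points M"
  using chart_dom_subset[OF assms(1), of \<kappa>] assms(2) by (auto simp: charts_at_def)

lemma chart_at_in_charts_at:
  assumes "smooth_manifold M" "p \<in> points M"
  shows "chart_at M p \<in> charts_at M p"
proof -
  have "\<exists>\<kappa>. \<kappa> \<in> charts_at M p"
    using assms unfolding smooth_manifold_def charts_at_def by blast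
  then show ?thesis
    unfolding chart_at_def by (rule someI_ex)
qed

lemma chart_overlap_open:
  assumes "smooth_manifold M" "\<kappa> \<in> atlas M" "\<theta> \<in> atlas M"
  shows "open (snd \<kappa> ` (chart_dom \<kappa> \<inter> chart_dom \<theta>))"
  using chart_image_open[OF assms(1,2)] smooth_manifold_chart[OF assms(1,3)]
  unfolding is_chart_def by blast

lemma transition_smooth_on:
  assumes "smooth_manifold M" "\<kappa> \<in> atlas M" "\<theta> \<in> atlas M"
  shows "smooth_on (snd \<kappa> ` (chart_dom \<kappa> \<inter> chart_dom \<theta>)) (snd \<theta> \<circ> param \<kappa>)"
  using assms unfolding smooth_manifold_def smooth_transition_def by blast

lemma transition_differentiable:
  assumes "smooth_manifold M" "\<kappa> \<in> charts_at M p" "\<theta> \<in> charts_at M p"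
  shows "(snd \<theta> \<circ> param \<kappa>) differentiable (at (snd \<kappa> p))"
  using assms transition_smooth_on smooth_on_imp_differentiable unfolding charts_at_def by blast

text \<open>Chain rule through the transition map, which factors \<open>g\<close> in coordinates on
  the overlap of the charts only. Leaving \<open>g\<close> general covers coordinate maps, which
  gives the transformation law, and coordinate maps composed with a smooth map, which gives
  differentials.\<close>

lemma chart_change_derivative:
  assumes M: "smooth_manifold M" and k: "\<kappa> \<in> charts_at M p" and t: "\<theta> \<in> charts_at M p"
    and g: "(g \<circ> param \<theta>) differentiable (at (snd \<theta> p))"
  shows "frechet_derivative (g \<circ> param \<kappa>) (at (snd \<kappa> p)) w =
         frechet_derivative (g \<circ> param \<theta>) (at (snd \<theta> p))
           (frechet_derivative (snd \<theta> \<circ> param \<kappa>) (at (snd \<kappa> p)) w)"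
proof -
  let ?O = "snd \<kappa> ` (chart_dom \<kappa> \<inter> chart_dom \<theta>)"
  have O: "open ?O" "snd \<kappa> p \<in> ?O"
    using chart_overlap_open[OF M, of \<kappa> \<theta>] k t by (auto simp: charts_at_def)
  have "(g \<circ> param \<kappa>) y = ((g \<circ> param \<theta>) \<circ> (snd \<theta> \<circ> param \<kappa>)) y" if "y \<in> ?O" for y
    using that M k t by (auto simp: charts_at_def)
  then have "frechet_derivative (g \<circ> param \<kappa>) (at (snd \<kappa> p)) =
      frechet_derivative ((g \<circ> param \<theta>) \<circ> (snd \<theta> \<circ> param \<kappa>)) (at (snd \<kappa> p))"
    using frechet_derivative_cong_open[OF O] by blast
  also have "\<dots> = frechet_derivative (g \<circ> param \<theta>) (at (snd \<theta> p)) \<circ>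
      frechet_derivative (snd \<theta> \<circ> param \<kappa>) (at (snd \<kappa> p))"
    using frechet_derivative_compose[OF transition_differentiable[OF M k t], of "g \<circ> param \<theta>"] g M k
    by (simp add: charts_at_def)
  finally show ?thesis
    by simp
qed

lemma transition_derivative_self:
  assumes "smooth_manifold M" "\<kappa> \<in> charts_at M p"
  shows "frechet_derivative (snd \<kappa> \<circ> param \<kappa>) (at (snd \<kappa> p)) w = w"
proof -
  have "frechet_derivative (snd \<kappa> \<circ> param \<kappa>) (at (snd \<kappa> p)) = frechet_derivative id (at (snd \<kappa> p))"
    using assms by (intro frechet_derivative_cong_open[of "snd \<kappa> ` (chart_dom \<kappa> \<inter> chart_dom \<kappa>)"]
        chart_overlap_open[of M]) (auto simp: charts_at_def)
  then show ?thesis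
    by simp
qed

lemma tangent_of_self:
  "smooth_manifold M \<Longrightarrow> \<kappa> \<in> charts_at M p \<Longrightarrow> tangent_of M \<kappa> p w \<kappa> = w"
  by (simp add: tangent_of_def transition_derivative_self)

text \<open>The transformation law between two further charts is the chain rule for the three
  transition maps involved.\<close>

lemma tangent_of_in_tangent_space:
  assumes "smooth_manifold M" "\<kappa> \<in> charts_at M p"
  shows "tangent_of M \<kappa> p w \<in> tangent_space M p"
proof -
  have "tangent_of M \<kappa> p w \<eta> =
      frechet_derivative (snd \<eta> \<circ> param \<theta>) (at (snd \<theta> p)) (tangent_of M \<kappa> p w \<theta>)"
    if "\<theta> \<in> charts_at M p" "\<eta> \<in> charts_at M p" for \<theta> \<eta>
    unfolding tangent_of_def if_P[OF that(1)] if_P[OF that(2)]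
    by (rule chart_change_derivative[OF assms that(1) transition_differentiable[OF assms(1) that]])
  moreover have "tangent_of M \<kappa> p w \<theta> = 0" if "\<theta> \<notin> charts_at M p" for \<theta>
    using that by (simp add: tangent_of_def)
  ultimately show ?thesis
    unfolding tangent_space_def by blast
qed

lemma tangent_space_transform:
  "v \<in> tangent_space M p \<Longrightarrow> \<kappa> \<in> charts_at M p \<Longrightarrow> \<theta> \<in> charts_at M p \<Longrightarrow>
    v \<theta> = frechet_derivative (snd \<theta> \<circ> param \<kappa>) (at (snd \<kappa> p)) (v \<kappa>)"
  unfolding tangent_space_def by blast

text \<open>Together with \<open>tangent_of_self\<close>, this makes each chart identify the tangent
  space with the model space. The value 0 at foreign charts turns agreement of coordinates into
  equality of functions.\<close>

lemma tangent_of_coordinates: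
  assumes "\<kappa> \<in> charts_at M p" "v \<in> tangent_space M p"
  shows "tangent_of M \<kappa> p (v \<kappa>) = v"
proof (rule ext)
  fix \<theta>
  show "tangent_of M \<kappa> p (v \<kappa>) \<theta> = v \<theta>"
  proof (cases "\<theta> \<in> charts_at M p")
    case True
    then show ?thesis
      using tangent_space_transform[OF assms(2,1) True] by (simp add: tangent_of_def)
  next
    case False
    then have "v \<theta> = 0"
      using assms(2) unfolding tangent_space_def by blast
    with False show ?thesis
      by (simp add: tangent_of_def)
  qed
qed

lemma tangent_of_change:
  assumes "smooth_manifold M" "\<kappa> \<in> charts_at M p" "\<theta> \<in> charts_at M p"
  shows "tangent_of M \<kappa> p w =
    tangent_of M \<theta> p (frechet_derivative (snd \<theta> \<circ> param \<kappa>) (at (snd \<kappa> p)) w)"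
  using tangent_of_coordinates[OF assms(3) tangent_of_in_tangent_space[OF assms(1,2)], of w] assms(3)
  by (simp add: tangent_of_def)

lemma tangent_of_linear:
  assumes "smooth_manifold M" "\<kappa> \<in> charts_at M p"
  shows "tangent_of M \<kappa> p (a *\<^sub>R v + b *\<^sub>R w) =
    (\<lambda>\<theta>. a *\<^sub>R tangent_of M \<kappa> p v \<theta> + b *\<^sub>R tangent_of M \<kappa> p w \<theta>)"
proof (rule ext)
  fix \<theta>
  show "tangent_of M \<kappa> p (a *\<^sub>R v + b *\<^sub>R w) \<theta> =
    a *\<^sub>R tangent_of M \<kappa> p v \<theta> + b *\<^sub>R tangent_of M \<kappa> p w \<theta>"
  proof (cases "\<theta> \<in> charts_at M p")
    case True
    then have "linear (frechet_derivative (snd \<theta> \<circ> param \<kappa>) (at (snd \<kappa> p)))"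
      using transition_differentiable[OF assms] linear_frechet_derivative
        by metis
    with True show ?thesis
      by (simp add: tangent_of_def linear_add linear_cmul)
  qed (simp add: tangent_of_def)
qed

lemma tangent_space_linear_comb:
  assumes "smooth_manifold M" "p \<in> points M" "v \<in> tangent_space M p" "w \<in> tangent_space M p"
  shows "(\<lambda>\<theta>. a *\<^sub>R v \<theta> + b *\<^sub>R w \<theta>) \<in> tangent_space M p"
proof -
  let ?k = "chart_at M p"
  have k: "?k \<in> charts_at M p"
    by (rule chart_at_in_charts_at[OF assms(1,2)])
  have "tangent_of M ?k p (a *\<^sub>R v ?k + b *\<^sub>R w ?k) = (\<lambda>\<theta>. a *\<^sub>R v \<theta> + b *\<^sub>R w \<theta>)"
    unfolding tangent_of_linear[OF assms(1) k] tangent_of_coordinates[OF k assms(3)]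
      tangent_of_coordinates[OF k assms(4)] ..
  then show ?thesis
    using tangent_of_in_tangent_space[OF assms(1) k, of "a *\<^sub>R v ?k + b *\<^sub>R w ?k"] by simp
qed

section \<open>Differentials of smooth maps\<close>

lemma smooth_map_differentiable:
  assumes "smooth_map M N f" "\<kappa> \<in> charts_at M p" "\<theta> \<in> charts_at N (f p)"
  shows "(snd \<theta> \<circ> f \<circ> param \<kappa>) differentiable (at (snd \<kappa> p))"
proof (rule smooth_on_imp_differentiable)
  show "smooth_on (snd \<kappa> ` (chart_dom \<kappa> \<inter> f -` chart_dom \<theta>)) (snd \<theta> \<circ> f \<circ> param \<kappa>)"
    using assms unfolding smooth_map_def charts_at_def by blast
  show "snd \<kappa> p \<in> snd \<kappa> ` (chart_dom \<kappa> \<inter> f -` chart_dom \<theta>)"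
    using assms(2,3) by (auto simp: charts_at_def)
qed

text \<open>Frees the differential from the chart picked by \<open>chart_at\<close>: the coordinates
  of \<open>v\<close> change by exactly the factor that the chain rule produces.\<close>

lemma differential_eq_in_chart:
  assumes "smooth_manifold M" "smooth_map M N f" "v \<in> tangent_space M p"
    and k: "\<kappa> \<in> charts_at M p" and t: "\<theta> \<in> charts_at N (f p)"
  shows "differential M N f p v \<theta> = frechet_derivative (snd \<theta> \<circ> f \<circ> param \<kappa>) (at (snd \<kappa> p)) (v \<kappa>)"
proof -
  let ?c = "chart_at M p"
  have "p \<in> points M"
    by (rule charts_at_point[OF assms(1) k])
  then have c: "?c \<in> charts_at M p"
    by (rule chart_at_in_charts_at[OF assms(1)])
  then have "v \<kappa> = frechet_derivative (snd \<kappa> \<circ> param ?c) (at (snd ?c p)) (v ?c)"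
    by (rule tangent_space_transform[OF assms(3) _ k])
  then show ?thesis
    using t chart_change_derivative[OF assms(1) c k smooth_map_differentiable[OF assms(2) k t]]
    by (simp add: differential_def Let_def)
qed

lemma differential_in_tangent_space:
  assumes M: "smooth_manifold M" and N: "smooth_manifold N" and f: "smooth_map M N f"
    and p: "p \<in> points M"
  shows "differential M N f p v \<in> tangent_space N (f p)"
proof -
  let ?k = "chart_at M p"
  have k: "?k \<in> charts_at M p"
    by (rule chart_at_in_charts_at[OF M p])
  have "frechet_derivative (snd \<eta> \<circ> f \<circ> param ?k) (at (snd ?k p)) (v ?k) =
      frechet_derivative (snd \<eta> \<circ> param \<theta>) (at (snd \<theta> (f p)))
        (frechet_derivative (snd \<theta> \<circ> f \<circ> param ?k) (at (snd ?k p)) (v ?k))"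
    if t: "\<theta> \<in> charts_at N (f p)" and e: "\<eta> \<in> charts_at N (f p)" for \<theta> \<eta>
  proof -
    \<comment> \<open>Near \<open>p\<close> the map must stay in the target chart for the
      factorization to make sense. Intersecting with the points of \<open>M\<close> is necessary
      because continuity controls preimages only there.\<close>
    let ?W = "{q \<in> points M. f q \<in> chart_dom \<theta>}"
    let ?O = "snd ?k ` (chart_dom ?k \<inter> ?W)"
    have "openin (mtop M) ?W"
      using f N t smooth_manifold_chart unfolding smooth_map_def is_chart_def charts_at_def
      by (blast intro: openin_continuous_map_preimage)
    then have O: "open ?O" "snd ?k p \<in> ?O"
      using chart_image_open[OF M, of ?k ?W] k p t by (auto simp: charts_at_def)
    have "(snd \<eta> \<circ> f \<circ> param ?k) y = ((snd \<eta> \<circ> param \<theta>) \<circ> (snd \<theta> \<circ> f \<circ> param ?k)) y"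
      if "y \<in> ?O" for y
      using that M N k t by (auto simp: charts_at_def)
    then have "frechet_derivative (snd \<eta> \<circ> f \<circ> param ?k) (at (snd ?k p)) =
        frechet_derivative ((snd \<eta> \<circ> param \<theta>) \<circ> (snd \<theta> \<circ> f \<circ> param ?k)) (at (snd ?k p))"
      using frechet_derivative_cong_open[OF O] by blast
    also have "\<dots> = frechet_derivative (snd \<eta> \<circ> param \<theta>) (at (snd \<theta> (f p))) \<circ>
        frechet_derivative (snd \<theta> \<circ> f \<circ> param ?k) (at (snd ?k p))"
      using frechet_derivative_compose[OF smooth_map_differentiable[OF f k t], of "snd \<eta> \<circ> param \<theta>"]
        transition_differentiable[OF N t e] M k
      by (simp add: charts_at_def)
    finally show ?thesis
      by simp
  qed
  then have "differential M N f p v \<eta> =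
      frechet_derivative (snd \<eta> \<circ> param \<theta>) (at (snd \<theta> (f p))) (differential M N f p v \<theta>)"
    if "\<theta> \<in> charts_at N (f p)" "\<eta> \<in> charts_at N (f p)" for \<theta> \<eta>
    using that unfolding differential_def if_P[OF that(1)] if_P[OF that(2)] Let_def by blast
  moreover have "differential M N f p v \<theta> = 0" if "\<theta> \<notin> charts_at N (f p)" for \<theta>
    using that by (simp add: differential_def)
  ultimately show ?thesis
    unfolding tangent_space_def by blast
qed

lemma differential_linear:
  assumes M: "smooth_manifold M" and f: "smooth_map M N f" and p: "p \<in> points M"
  shows "differential M N f p (\<lambda>\<theta>. a *\<^sub>R v \<theta> + b *\<^sub>R w \<theta>) =
    (\<lambda>\<theta>. a *\<^sub>R differential M N f p v \<theta> + b *\<^sub>R differential M N f p w \<theta>)"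
proof (rule ext)
  fix \<theta>
  show "differential M N f p (\<lambda>\<theta>. a *\<^sub>R v \<theta> + b *\<^sub>R w \<theta>) \<theta> =
    a *\<^sub>R differential M N f p v \<theta> + b *\<^sub>R differential M N f p w \<theta>"
  proof (cases "\<theta> \<in> charts_at N (f p)")
    case True
    then have "linear (frechet_derivative (snd \<theta> \<circ> f \<circ> param (chart_at M p)) (at (snd (chart_at M p) p)))"
      using smooth_map_differentiable[OF f chart_at_in_charts_at[OF M p]] linear_frechet_derivative
        by metis
    with True show ?thesis
      by (simp add: differential_def Let_def linear_add linear_cmul)
  qed (simp add: differential_def)
qed

section \<open>Exterior derivative and exact forms\<close>

lemma local_rep_linear:
  assumes M: "smooth_manifold M" and "one_form_on M W \<alpha>" "\<kappa> \<in> atlas M"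
    and "x \<in> snd \<kappa> ` (chart_dom \<kappa> \<inter> W)"
  shows "local_rep M \<kappa> \<alpha> w x = (\<Sum>b\<in>Basis. (w \<bullet> b) * local_rep M \<kappa> \<alpha> b x)"
proof (rule linear_comb_on_Basis)
  fix a b v w
  have p: "param \<kappa> x \<in> W" "\<kappa> \<in> charts_at M (param \<kappa> x)"
    using assms by (auto simp: charts_at_def)
  then have "local_rep M \<kappa> \<alpha> (a *\<^sub>R v + b *\<^sub>R w) x = \<alpha> (param \<kappa> x)
      (\<lambda>\<theta>. a *\<^sub>R tangent_of M \<kappa> (param \<kappa> x) v \<theta> + b *\<^sub>R tangent_of M \<kappa> (param \<kappa> x) w \<theta>)"
    by (simp add: local_rep_def tangent_of_linear M)
  with p assms(2) show "local_rep M \<kappa> \<alpha> (a *\<^sub>R v + b *\<^sub>R w) x =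
      a * local_rep M \<kappa> \<alpha> v x + b * local_rep M \<kappa> \<alpha> w x"
    by (simp add: one_form_on_def local_rep_def tangent_of_in_tangent_space M)
qed

lemma local_rep_differentiable:
  assumes "one_form_on M W \<alpha>" "\<kappa> \<in> atlas M" "x \<in> snd \<kappa> ` (chart_dom \<kappa> \<inter> W)"
  shows "local_rep M \<kappa> \<alpha> w differentiable (at x)"
  using assms smooth_on_imp_differentiable unfolding one_form_on_def by blast

text \<open>On the overlap, the coefficient in \<kappa> at \<open>y\<close> is the coefficient in
  \<theta> at the point \<open>\<tau> y\<close> on the vector D\<tau>(y)w. The variable enters
  twice, so differentiation yields one term with the second derivative of \<tau> and one with the
  derivative of the coefficients.\<close>

lemma local_rep_derivative_change:
  assumes M: "smooth_manifold M" and a: "one_form M \<alpha>"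
    and k: "\<kappa> \<in> charts_at M p" and t: "\<theta> \<in> charts_at M p"
  defines "\<tau> \<equiv> snd \<theta> \<circ> param \<kappa>"
  shows "frechet_derivative (local_rep M \<kappa> \<alpha> w) (at (snd \<kappa> p)) v =
    local_rep M \<theta> \<alpha> (frechet_derivative (\<lambda>y. frechet_derivative \<tau> (at y) w) (at (snd \<kappa> p)) v) (snd \<theta> p) +
    frechet_derivative (local_rep M \<theta> \<alpha> (frechet_derivative \<tau> (at (snd \<kappa> p)) w)) (at (snd \<theta> p))
      (frechet_derivative \<tau> (at (snd \<kappa> p)) v)"
proof -
  let ?O = "snd \<kappa> ` (chart_dom \<kappa> \<inter> chart_dom \<theta>)"
  let ?x = "snd \<kappa> p"
  let ?D = "\<lambda>y. frechet_derivative \<tau> (at y)"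
  let ?A = "local_rep M \<theta> \<alpha>"
  let ?A' = "\<lambda>c. frechet_derivative (?A c) (at (snd \<theta> p))"
  let ?B = "\<lambda>v. frechet_derivative (\<lambda>y. ?D y w) (at ?x) v"
  have kt: "\<kappa> \<in> atlas M" "\<theta> \<in> atlas M" "p \<in> chart_dom \<kappa>" "p \<in> chart_dom \<theta>"
    using k t by (auto simp: charts_at_def)
  have sub: "chart_dom \<kappa> \<subseteq> points M" "chart_dom \<theta> \<subseteq> points M"
    using chart_dom_subset M kt by blast+
  have O: "open ?O" "?x \<in> ?O"
    using chart_overlap_open[OF M kt(1,2)] kt by auto
  have \<tau>x: "\<tau> ?x = snd \<theta> p"
    using M kt by (simp add: \<tau>_def)
  have \<tau>: "smooth_on ?O \<tau>"
    using transition_smooth_on M kt unfolding \<tau>_def by blast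
  have d\<tau>: "(\<tau> has_derivative ?D ?x) (at ?x)"
    by (rule smooth_on_has_derivative[OF \<tau> O(2)])
  have dD: "((\<lambda>y. ?D y w) has_derivative ?B) (at ?x)"
    by (rule smooth_on_has_derivative[OF smooth_on_frechet_derivative[OF \<tau>] O(2)])
  have px: "snd \<theta> p \<in> snd \<theta> ` (chart_dom \<theta> \<inter> points M)"
    using kt sub by blast
  have dA: "(?A c has_derivative ?A' c) (at (snd \<theta> p))" for c
    using local_rep_differentiable[OF a kt(2) px] by (simp add: frechet_derivative_works)
  \<comment> \<open>Expanding over the basis separates the two occurrences of \<open>y\<close> into
    products of scalar functions.\<close>
  have eq: "local_rep M \<kappa> \<alpha> w y = (\<Sum>b\<in>Basis. (?D y w \<bullet> b) * ?A b (\<tau> y))" if y: "y \<in> ?O" for y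
  proof -
    obtain q where q: "q \<in> chart_dom \<kappa>" "q \<in> chart_dom \<theta>" "y = snd \<kappa> q"
      using y by blast
    then have "\<tau> y = snd \<theta> q" "param \<kappa> y = q"
      using M kt by (simp_all add: \<tau>_def)
    moreover have "\<kappa> \<in> charts_at M q" "\<theta> \<in> charts_at M q"
      using q kt by (auto simp: charts_at_def)
    ultimately have "local_rep M \<kappa> \<alpha> w y = ?A (?D y w) (\<tau> y)"
      using tangent_of_change[OF M, of \<kappa> q \<theta> w] M q kt
      by (simp add: local_rep_def \<tau>_def)
    also have "\<dots> = (\<Sum>b\<in>Basis. (?D y w \<bullet> b) * ?A b (\<tau> y))"
      using \<open>\<tau> y = snd \<theta> q\<close> q sub by (intro local_rep_linear[OF M a kt(2)]) auto
    finally show ?thesis .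
  qed
  have dAt: "((\<lambda>y. ?A b (\<tau> y)) has_derivative (\<lambda>v. ?A' b (?D ?x v))) (at ?x)" for b
    using has_derivative_compose[OF d\<tau>] dA \<tau>x by metis
  have "((\<lambda>y. \<Sum>b\<in>Basis. (?D y w \<bullet> b) * ?A b (\<tau> y)) has_derivative
      (\<lambda>v. \<Sum>b\<in>Basis. (?D ?x w \<bullet> b) * ?A' b (?D ?x v) + (?B v \<bullet> b) * ?A b (\<tau> ?x))) (at ?x)"
    by (intro has_derivative_sum has_derivative_mult has_derivative_inner_left dD dAt)
  then have d\<kappa>: "(local_rep M \<kappa> \<alpha> w has_derivative
      (\<lambda>v. \<Sum>b\<in>Basis. (?D ?x w \<bullet> b) * ?A' b (?D ?x v) + (?B v \<bullet> b) * ?A b (\<tau> ?x))) (at ?x)"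
    by (rule has_derivative_transform_within_open[OF _ O]) (rule eq[symmetric])
  have 1: "frechet_derivative (local_rep M \<kappa> \<alpha> w) (at ?x) v =
      (\<Sum>b\<in>Basis. (?D ?x w \<bullet> b) * ?A' b (?D ?x v) + (?B v \<bullet> b) * ?A b (\<tau> ?x))"
    unfolding frechet_derivative_at[OF d\<kappa>, symmetric] ..
  have 2: "?A (?B v) (snd \<theta> p) = (\<Sum>b\<in>Basis. (?B v \<bullet> b) * ?A b (\<tau> ?x))"
    unfolding \<tau>x by (rule local_rep_linear[OF M a kt(2) px])
  \<comment> \<open>Collects the basis terms again: for a constant vector \<open>c\<close>,
    differentiation commutes with the expansion.\<close>
  have d\<theta>: "(?A c has_derivative (\<lambda>u. \<Sum>b\<in>Basis. (c \<bullet> b) * ?A' b u)) (at (snd \<theta> p))" for c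
  proof (rule has_derivative_transform_within_open)
    show "((\<lambda>z. \<Sum>b\<in>Basis. (c \<bullet> b) * ?A b z) has_derivative
      (\<lambda>u. \<Sum>b\<in>Basis. (c \<bullet> b) * ?A' b u)) (at (snd \<theta> p))"
      by (intro has_derivative_sum has_derivative_mult_right dA)
    show "open (snd \<theta> ` (chart_dom \<theta> \<inter> points M))"
      by (rule chart_image_open[OF M kt(2) openin_topspace])
    show "snd \<theta> p \<in> snd \<theta> ` (chart_dom \<theta> \<inter> points M)"
      by (rule px)
    show "(\<Sum>b\<in>Basis. (c \<bullet> b) * ?A b z) = ?A c z" if "z \<in> snd \<theta> ` (chart_dom \<theta> \<inter> points M)" for z
      by (rule local_rep_linear[OF M a kt(2) that, symmetric])
  qed
  have 3: "?A' c u = (\<Sum>b\<in>Basis. (c \<bullet> b) * ?A' b u)" for c u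
    by (rule fun_cong[OF frechet_derivative_at[OF d\<theta>[of c], symmetric]])
  show ?thesis
    unfolding 1 2 3[of "?D ?x w"] by (simp add: sum.distrib)
qed

text \<open>The coordinate expression of the exterior derivative does not depend on the chart: the second
  derivatives of the transition map enter symmetrically and cancel.\<close>

lemma ext_deriv_eq_in_chart:
  assumes M: "smooth_manifold M" and a: "one_form M \<alpha>" and k: "\<kappa> \<in> charts_at M p"
    and v: "v \<in> tangent_space M p" and w: "w \<in> tangent_space M p"
  shows "ext_deriv M \<alpha> p v w =
    frechet_derivative (local_rep M \<kappa> \<alpha> (w \<kappa>)) (at (snd \<kappa> p)) (v \<kappa>) -
    frechet_derivative (local_rep M \<kappa> \<alpha> (v \<kappa>)) (at (snd \<kappa> p)) (w \<kappa>)"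
proof -
  let ?c = "chart_at M p"
  have "p \<in> points M"
    by (rule charts_at_point[OF M k])
  then have c: "?c \<in> charts_at M p"
    by (rule chart_at_in_charts_at[OF M])
  have O: "open (snd \<kappa> ` (chart_dom \<kappa> \<inter> chart_dom ?c))"
    "snd \<kappa> p \<in> snd \<kappa> ` (chart_dom \<kappa> \<inter> chart_dom ?c)"
    "smooth_on (snd \<kappa> ` (chart_dom \<kappa> \<inter> chart_dom ?c)) (snd ?c \<circ> param \<kappa>)"
    using chart_overlap_open[OF M, of \<kappa> ?c] transition_smooth_on[OF M, of \<kappa> ?c] k c
    by (auto simp: charts_at_def)
  have "u ?c = frechet_derivative (snd ?c \<circ> param \<kappa>) (at (snd \<kappa> p)) (u \<kappa>)"
    if "u \<in> tangent_space M p" for u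
    by (rule tangent_space_transform[OF that k c])
  \<comment> \<open>The derivatives in \<kappa> are rewritten into the picked chart. The
    coefficients left over on second derivatives of the transition map are equal for both orders of
    \<open>v\<close> and \<open>w\<close>.\<close>
  then show ?thesis
    using v w second_derivative_symmetric[OF O, of "w \<kappa>" "v \<kappa>"]
    by (simp add: ext_deriv_def Let_def local_rep_derivative_change[OF M a k c])
qed

section \<open>Zeros of exact forms, and nonzero de Rham classes\<close>

lemma smooth_function_continuous_map:
  assumes M: "smooth_manifold M" and f: "smooth_function M f"
  shows "continuous_map (mtop M) euclideanreal f"
proof -
  \<comment> \<open>Smoothness is stated in charts alone, so continuity for the topology of
    \<open>M\<close> is recovered locally: on a chart domain \<open>f\<close> is the composition of
    its coordinate expression with the chart.\<close>
  have "openin (mtop M) {p \<in> points M. f p \<in> V}" if V: "open V" for V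
  proof (subst openin_subopen, intro ballI)
    fix p assume "p \<in> {p \<in> points M. f p \<in> V}"
    then obtain \<kappa> where k: "\<kappa> \<in> atlas M" "p \<in> chart_dom \<kappa>" and p: "f p \<in> V"
      using M unfolding smooth_manifold_def by blast
    let ?I = "snd \<kappa> ` chart_dom \<kappa>"
    let ?X = "subtopology (mtop M) (chart_dom \<kappa>)"
    have ch: "openin (mtop M) (chart_dom \<kappa>)" "continuous_map ?X (top_of_set ?I) (snd \<kappa>)"
      using smooth_manifold_chart[OF M k(1)] homeomorphic_imp_continuous_map
      unfolding is_chart_def by blast+
    have "continuous_on ?I (f \<circ> param \<kappa>)"
      using f k(1) unfolding smooth_function_def by (blast intro: smooth_on_imp_continuous_on)
    then have "continuous_map (top_of_set ?I) euclideanreal (f \<circ> param \<kappa>)"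
      by (simp only: continuous_map_iff_continuous)
    then have "continuous_map ?X euclideanreal (f \<circ> param \<kappa> \<circ> snd \<kappa>)"
      using continuous_map_compose[OF ch(2)] by blast
    then have "openin ?X {q \<in> topspace ?X. (f \<circ> param \<kappa> \<circ> snd \<kappa>) q \<in> V}"
      using V openin_continuous_map_preimage open_openin by blast
    moreover have "{q \<in> topspace ?X. (f \<circ> param \<kappa> \<circ> snd \<kappa>) q \<in> V} = {q \<in> chart_dom \<kappa>. f q \<in> V}"
      using chart_dom_subset[OF M k(1)] M k by auto
    ultimately have "openin (mtop M) {q \<in> chart_dom \<kappa>. f q \<in> V}"
      using ch(1) openin_trans_full by auto
    then show "\<exists>T. openin (mtop M) T \<and> p \<in> T \<and> T \<subseteq> {p \<in> points M. f p \<in> V}"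
      using k p chart_dom_subset[OF M k(1)] by blast
  qed
  then show ?thesis
    by (simp add: continuous_map_def)
qed

lemma fun_differential_vanishes_somewhere:
  assumes L: "closed_manifold L" and f: "smooth_function L f"
  obtains p where "p \<in> points L" "\<And>v. fun_differential L f p v = 0"
proof -
  have M: "smooth_manifold L"
    using L by (simp add: closed_manifold_def)
  have "compact (f ` points L)"
    using image_compactin[of "mtop L" "points L" euclideanreal f] smooth_function_continuous_map[OF M f] L
    by (simp add: closed_manifold_def compact_space_def)
  moreover have "f ` points L \<noteq> {}"
    using M by (simp add: smooth_manifold_def)
  ultimately obtain p where p: "p \<in> points L" "\<And>q. q \<in> points L \<Longrightarrow> f q \<le> f p"
    using compact_attains_sup[of "f ` points L"] by auto
  let ?k = "chart_at L p"
  let ?O = "snd ?k ` (chart_dom ?k \<inter> chart_dom ?k)"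
  have k: "?k \<in> atlas L" "p \<in> chart_dom ?k"
    using chart_at_in_charts_at[OF M p(1)] by (simp_all add: charts_at_def)
  have O: "open ?O" "snd ?k p \<in> ?O"
    using chart_overlap_open[OF M k(1,1)] k by auto
  have "smooth_on (snd ?k ` chart_dom ?k) (f \<circ> param ?k)"
    using f k unfolding smooth_function_def by blast
  then have "(f \<circ> param ?k has_derivative frechet_derivative (f \<circ> param ?k) (at (snd ?k p))) (at (snd ?k p))"
    using k(2) by (rule smooth_on_has_derivative[OF _ imageI])
  \<comment> \<open>The chart image is open in the model space, so the maximum is interior there and
    the derivative vanishes.\<close>
  moreover have "\<forall>y\<in>?O. (f \<circ> param ?k) y \<le> (f \<circ> param ?k) (snd ?k p)"
    using M k p(2) chart_dom_subset[OF M k(1)] by auto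
  ultimately have "frechet_derivative (f \<circ> param ?k) (at (snd ?k p)) = (\<lambda>v. 0)"
    using differential_zero_maxmin[OF O(2,1)] by blast
  then have "fun_differential L f p v = 0" for v
    by (simp add: fun_differential_def Let_def)
  with p(1) that show ?thesis
    by blast
qed

lemma zero_in_exact_forms: "(\<lambda>p v. 0) \<in> exact_forms M"
proof -
  have "smooth_function M (\<lambda>p. 0)"
    by (simp add: smooth_function_def comp_def smooth_on_const)
  moreover have "fun_differential M (\<lambda>p. 0) = (\<lambda>p v. 0)"
    by (auto simp: fun_differential_def comp_def Let_def intro!: ext)
  ultimately show ?thesis
    unfolding exact_forms_def by (metis (mono_tags, lifting) mem_Collect_eq)
qed

text \<open>The unit of the quotient is \<open>exact_forms\<close> itself, and the coset of \<alpha>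
  contains \<alpha> because the zero form is exact.\<close>

lemma deRham_class_eq_one_imp_exact:
  assumes "deRham_class M \<alpha> = \<one>\<^bsub>deRham_H1 M\<^esub>"
  shows "\<alpha> \<in> exact_forms M"
proof -
  have "\<alpha> \<in> deRham_class M \<alpha>"
    using zero_in_exact_forms[of M] unfolding deRham_class_def r_coset_def closed_forms_def by force
  then show ?thesis
    using assms by (simp add: deRham_H1_def)
qed

lemma nowhere_zero_deRham_class_ne_one:
  assumes "closed_manifold L" "\<And>p. p \<in> points L \<Longrightarrow> \<exists>v. \<alpha> p v \<noteq> 0"
  shows "deRham_class L \<alpha> \<noteq> \<one>\<^bsub>deRham_H1 L\<^esub>"
proof
  assume "deRham_class L \<alpha> = \<one>\<^bsub>deRham_H1 L\<^esub>"
  then obtain f where "smooth_function L f" "\<alpha> = fun_differential L f"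
    using deRham_class_eq_one_imp_exact unfolding exact_forms_def by blast
  then show False
    using fun_differential_vanishes_somewhere[OF assms(1)] assms(2) by metis
qed

section \<open>The image of an embedding\<close>

definition image_chart ::
    "('a, 'e) manifold \<Rightarrow> ('a \<Rightarrow> 'b) \<Rightarrow> ('a, 'e) chart \<Rightarrow> ('b, 'e) chart" where
  "image_chart M f \<kappa> = (f ` chart_dom \<kappa>, snd \<kappa> \<circ> inv_into (points M) f)"

lemma atlas_image_manifold: "atlas (image_manifold M N f) = image_chart M f ` atlas M"
  by (simp add: image_manifold_def image_chart_def)

text \<open>Smoothness of the image manifold is assumed here; in the theorem it is part of the image
  being a submanifold.\<close>

locale embedded_image =
  fixes L :: "('b, 'e::euclidean_space) manifold" and U :: "('a, 'f::euclidean_space) manifold"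
    and \<phi> :: "'b \<Rightarrow> 'a"
  assumes smooth_L: "smooth_manifold L" and cont: "continuous_map (mtop L) (mtop U) \<phi>"
    and inj: "inj_on \<phi> (points L)" and smooth_S: "smooth_manifold (image_manifold L U \<phi>)"
begin

abbreviation "S \<equiv> image_manifold L U \<phi>"

abbreviation "\<iota> \<equiv> image_chart L \<phi>"

lemma points_S: "points S = \<phi> ` points L"
  using continuous_map_image_subset_topspace[OF cont] by (auto simp: image_manifold_def)

lemma image_chart_apply [simp]: "p \<in> points L \<Longrightarrow> snd (\<iota> \<kappa>) (\<phi> p) = snd \<kappa> p"
  by (simp add: image_chart_def inj)

lemma image_chart_in_charts_at: "\<kappa> \<in> charts_at L p \<Longrightarrow> \<iota> \<kappa> \<in> charts_at S (\<phi> p)"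
  by (simp add: charts_at_def atlas_image_manifold) (simp add: image_chart_def)

lemma chart_dom_image_chart_iff:
  assumes "\<kappa> \<in> atlas L" "p \<in> points L"
  shows "\<phi> p \<in> chart_dom (\<iota> \<kappa>) \<longleftrightarrow> p \<in> chart_dom \<kappa>"
  using chart_dom_subset[OF smooth_L assms(1)] assms(2) inj
  by (simp add: image_chart_def inj_on_image_mem_iff)

lemma param_image_chart:
  assumes "\<kappa> \<in> charts_at L p"
  shows "param (\<iota> \<kappa>) (snd \<kappa> p) = \<phi> p"
proof -
  have "\<iota> \<kappa> \<in> atlas S" "\<phi> p \<in> chart_dom (\<iota> \<kappa>)"
    using image_chart_in_charts_at[OF assms] by (simp_all add: charts_at_def)
  from param_chart[OF smooth_S this] show ?thesis
    by (simp add: charts_at_point[OF smooth_L assms])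
qed

text \<open>Near the point, the parametrization by the carried chart is \<phi> after the
  parametrization by \<kappa>.\<close>

lemma image_chart_derivative:
  assumes "\<kappa> \<in> charts_at L p"
  shows "frechet_derivative (h \<circ> param (\<iota> \<kappa>)) (at (snd \<kappa> p)) =
    frechet_derivative (h \<circ> \<phi> \<circ> param \<kappa>) (at (snd \<kappa> p))"
proof (rule frechet_derivative_cong_open)
  have k: "\<kappa> \<in> atlas L" "p \<in> chart_dom \<kappa>"
    using assms by (simp_all add: charts_at_def)
  show "open (snd \<kappa> ` (chart_dom \<kappa> \<inter> chart_dom \<kappa>))"
    by (rule chart_overlap_open[OF smooth_L k(1) k(1)])
  show "snd \<kappa> p \<in> snd \<kappa> ` (chart_dom \<kappa> \<inter> chart_dom \<kappa>)"
    using k by blast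
  fix y assume "y \<in> snd \<kappa> ` (chart_dom \<kappa> \<inter> chart_dom \<kappa>)"
  then obtain q where q: "q \<in> chart_dom \<kappa>" "y = snd \<kappa> q"
    by blast
  then have "\<kappa> \<in> charts_at L q"
    using k by (simp add: charts_at_def)
  then show "(h \<circ> param (\<iota> \<kappa>)) y = (h \<circ> \<phi> \<circ> param \<kappa>) y"
    using param_image_chart[of \<kappa> q] param_chart[OF smooth_L k(1) q(1)] q(2) by simp
qed

text \<open>Read in \<kappa> and a carried chart, \<phi> is a transition map of
  \<open>L\<close>.\<close>

lemma smooth_map_to_image: "smooth_map L S \<phi>"
  unfolding smooth_map_def
proof (intro conjI ballI)
  show "continuous_map (mtop L) (mtop S) \<phi>"
    using cont by (simp add: image_manifold_def continuous_map_in_subtopology)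
next
  fix \<kappa> \<theta>' assume k: "\<kappa> \<in> atlas L" and "\<theta>' \<in> atlas S"
  then obtain \<theta> where t: "\<theta> \<in> atlas L" "\<theta>' = \<iota> \<theta>"
    unfolding atlas_image_manifold by blast
  have "chart_dom \<kappa> \<inter> \<phi> -` chart_dom \<theta>' = chart_dom \<kappa> \<inter> chart_dom \<theta>"
    using chart_dom_image_chart_iff[OF t(1)] chart_dom_subset[OF smooth_L k] t(2) by blast
  moreover have "smooth_on (snd \<kappa> ` (chart_dom \<kappa> \<inter> chart_dom \<theta>)) (snd \<theta>' \<circ> \<phi> \<circ> param \<kappa>)"
  proof (subst smooth_on_cong_open)
    show "open (snd \<kappa> ` (chart_dom \<kappa> \<inter> chart_dom \<theta>))"
      by (rule chart_overlap_open[OF smooth_L k t(1)])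
    show "smooth_on (snd \<kappa> ` (chart_dom \<kappa> \<inter> chart_dom \<theta>)) (snd \<theta> \<circ> param \<kappa>)"
      by (rule transition_smooth_on[OF smooth_L k t(1)])
    fix y assume "y \<in> snd \<kappa> ` (chart_dom \<kappa> \<inter> chart_dom \<theta>)"
    then obtain q where q: "q \<in> chart_dom \<kappa>" "y = snd \<kappa> q"
      by blast
    moreover have "q \<in> points L"
      using q chart_dom_subset[OF smooth_L k] by blast
    ultimately show "(snd \<theta>' \<circ> \<phi> \<circ> param \<kappa>) y = (snd \<theta> \<circ> param \<kappa>) y"
      using param_chart[OF smooth_L k q(1)] t(2) by simp
  qed
  ultimately show "smooth_on (snd \<kappa> ` (chart_dom \<kappa> \<inter> \<phi> -` chart_dom \<theta>')) (snd \<theta>' \<circ> \<phi> \<circ> param \<kappa>)"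
    by simp
qed

lemma differential_to_image:
  assumes "\<kappa> \<in> charts_at L p" "v \<in> tangent_space L p"
  shows "differential L S \<phi> p v = tangent_of S (\<iota> \<kappa>) (\<phi> p) (v \<kappa>)"
proof (rule ext)
  fix \<theta>
  have p: "p \<in> points L"
    by (rule charts_at_point[OF smooth_L assms(1)])
  show "differential L S \<phi> p v \<theta> = tangent_of S (\<iota> \<kappa>) (\<phi> p) (v \<kappa>) \<theta>"
  proof (cases "\<theta> \<in> charts_at S (\<phi> p)")
    case True
    show ?thesis
      unfolding differential_eq_in_chart[OF smooth_L smooth_map_to_image assms(2,1) True]
        tangent_of_def if_P[OF True] image_chart_apply[OF p] image_chart_derivative[OF assms(1)] ..
  next
    case False
    then show ?thesis
      by (simp add: differential_def tangent_of_def)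
  qed
qed

text \<open>\<phi> into \<open>U\<close> is the inclusion of the image after \<phi>, so the vector
  of \<open>L\<close> with the same coordinates as \<open>u\<close> has the same image in
  \<open>U\<close>.\<close>

lemma differential_inclusion_image:
  assumes i: "smooth_map S U id" and p: "p \<in> points L" and u: "u \<in> tangent_space S (\<phi> p)"
  obtains v where "v \<in> tangent_space L p" "differential S U id (\<phi> p) u = differential L U \<phi> p v"
proof
  let ?k = "chart_at L p"
  let ?v = "tangent_of L ?k p (u (\<iota> ?k))"
  have k: "?k \<in> charts_at L p"
    by (rule chart_at_in_charts_at[OF smooth_L p])
  show "?v \<in> tangent_space L p"
    by (rule tangent_of_in_tangent_space[OF smooth_L k])
  show "differential S U id (\<phi> p) u = differential L U \<phi> p ?v"
  proof (rule ext)
    fix \<theta>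
    show "differential S U id (\<phi> p) u \<theta> = differential L U \<phi> p ?v \<theta>"
    proof (cases "\<theta> \<in> charts_at U (\<phi> p)")
      case True
      then have "\<theta> \<in> charts_at U (id (\<phi> p))"
        by simp
      from differential_eq_in_chart[OF smooth_S i u image_chart_in_charts_at[OF k] this]
      have "differential S U id (\<phi> p) u \<theta> =
          frechet_derivative (snd \<theta> \<circ> \<phi> \<circ> param ?k) (at (snd ?k p)) (u (\<iota> ?k))"
        unfolding image_chart_apply[OF p] comp_id image_chart_derivative[OF k] .
      then show ?thesis
        using True unfolding differential_def[of L] Let_def tangent_of_self[OF smooth_L k] by simp
    next
      case False
      then show ?thesis
        by (simp add: differential_def)
    qed
  qed
qed

text \<open>Equal coefficients in corresponding charts let smoothness and the exterior derivative
  pass to the pullback without further computation.\<close>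

lemma local_rep_pullback:
  assumes "\<kappa> \<in> atlas L" "x \<in> snd \<kappa> ` chart_dom \<kappa>"
  shows "local_rep L \<kappa> (pullback L S \<phi> \<alpha>) w x = local_rep S (\<iota> \<kappa>) \<alpha> w x"
proof -
  obtain p where p: "p \<in> chart_dom \<kappa>" "x = snd \<kappa> p"
    using assms by blast
  then have k: "\<kappa> \<in> charts_at L p"
    using assms by (simp add: charts_at_def)
  have px: "param \<kappa> x = p"
    using param_chart[OF smooth_L assms(1) p(1)] p(2) by simp
  have px': "param (\<iota> \<kappa>) x = \<phi> p"
    using param_image_chart[OF k] p(2) by simp
  have t: "tangent_of L \<kappa> p w \<in> tangent_space L p"
    by (rule tangent_of_in_tangent_space[OF smooth_L k])
  show ?thesis
    unfolding local_rep_def px px' pullback_def differential_to_image[OF k t]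
      tangent_of_self[OF smooth_L k]
    using t charts_at_point[OF smooth_L k] by simp
qed

lemma one_form_pullback:
  assumes a: "one_form S \<alpha>"
  shows "one_form L (pullback L S \<phi> \<alpha>)"
  unfolding one_form_on_def
proof (intro conjI allI ballI impI)
  fix p v assume "p \<notin> points L \<or> v \<notin> tangent_space L p"
  then show "pullback L S \<phi> \<alpha> p v = 0"
    by (auto simp: pullback_def)
next
  fix p v w a b
  assume p: "p \<in> points L" and v: "v \<in> tangent_space L p" and w: "w \<in> tangent_space L p"
  let ?D = "differential L S \<phi> p"
  have "\<alpha> (\<phi> p) (\<lambda>\<theta>. a *\<^sub>R ?D v \<theta> + b *\<^sub>R ?D w \<theta>) = a * \<alpha> (\<phi> p) (?D v) + b * \<alpha> (\<phi> p) (?D w)"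
    using assms p points_S differential_in_tangent_space[OF smooth_L smooth_S smooth_map_to_image p]
    unfolding one_form_on_def by blast
  then show "pullback L S \<phi> \<alpha> p (\<lambda>\<kappa>. a *\<^sub>R v \<kappa> + b *\<^sub>R w \<kappa>) =
      a * pullback L S \<phi> \<alpha> p v + b * pullback L S \<phi> \<alpha> p w"
    using p v w tangent_space_linear_comb[OF smooth_L p v w, of a b]
    by (simp add: pullback_def differential_linear[OF smooth_L smooth_map_to_image p])
next
  fix \<kappa> w assume k: "\<kappa> \<in> atlas L"
  have dom: "chart_dom \<kappa> \<inter> points L = chart_dom \<kappa>"
    using chart_dom_subset[OF smooth_L k] by blast
  have k': "\<iota> \<kappa> \<in> atlas S"
    using k by (simp add: atlas_image_manifold)
  \<comment> \<open>Corresponding charts have the same image in the model space, so smoothness of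
    the coefficients is asserted on the same open set.\<close>
  have "snd (\<iota> \<kappa>) ` (chart_dom (\<iota> \<kappa>) \<inter> points S) = snd (\<iota> \<kappa>) ` \<phi> ` chart_dom \<kappa>"
    using chart_dom_subset[OF smooth_S k'] by (simp add: image_chart_def Int_absorb2)
  also have "\<dots> = snd \<kappa> ` chart_dom \<kappa>"
    unfolding image_image
  proof (rule image_cong[OF refl])
    show "snd (\<iota> \<kappa>) (\<phi> q) = snd \<kappa> q" if "q \<in> chart_dom \<kappa>" for q
      using that dom by (intro image_chart_apply) blast
  qed
  finally have sm: "smooth_on (snd \<kappa> ` chart_dom \<kappa>) (local_rep S (\<iota> \<kappa>) \<alpha> w)"
    using a k' unfolding one_form_on_def by metis
  have O: "open (snd \<kappa> ` chart_dom \<kappa>)"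
    using chart_overlap_open[OF smooth_L k k] by simp
  show "smooth_on (snd \<kappa> ` (chart_dom \<kappa> \<inter> points L)) (local_rep L \<kappa> (pullback L S \<phi> \<alpha>) w)"
    unfolding dom by (rule iffD2[OF smooth_on_cong_open[OF O local_rep_pullback[OF k]] sm])
qed

text \<open>The exterior derivative on the image is defined in \<open>chart_at S (\<phi> p)\<close>,
  which need not be the chart carried over from \<open>chart_at L p\<close>. Chart independence
  moves it there, where the coefficients agree.\<close>

lemma closed_form_pullback:
  assumes a: "one_form S \<alpha>" and c: "closed_form S \<alpha>"
  shows "closed_form L (pullback L S \<phi> \<alpha>)"
  unfolding closed_form_def
proof (intro ballI)
  fix p v w assume p: "p \<in> points L"
  let ?k = "chart_at L p"
  let ?t = "\<lambda>v. tangent_of S (\<iota> ?k) (\<phi> p) (v ?k)"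
  have k: "?k \<in> charts_at L p"
    by (rule chart_at_in_charts_at[OF smooth_L p])
  then have k': "?k \<in> atlas L" "p \<in> chart_dom ?k"
    by (simp_all add: charts_at_def)
  have ik: "\<iota> ?k \<in> charts_at S (\<phi> p)"
    by (rule image_chart_in_charts_at[OF k])
  have t: "?t v \<in> tangent_space S (\<phi> p)" for v
    by (rule tangent_of_in_tangent_space[OF smooth_S ik])
  have O: "open (snd ?k ` chart_dom ?k)" "snd ?k p \<in> snd ?k ` chart_dom ?k"
    using chart_overlap_open[OF smooth_L k'(1,1)] k' by auto
  have "frechet_derivative (local_rep L ?k (pullback L S \<phi> \<alpha>) u) (at (snd ?k p)) =
      frechet_derivative (local_rep S (\<iota> ?k) \<alpha> u) (at (snd ?k p))" for u
    by (rule frechet_derivative_cong_open[OF O local_rep_pullback[OF k'(1)]])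
  then have "ext_deriv L (pullback L S \<phi> \<alpha>) p v w = ext_deriv S \<alpha> (\<phi> p) (?t v) (?t w)"
    unfolding ext_deriv_eq_in_chart[OF smooth_S a ik t t] tangent_of_self[OF smooth_S ik]
      image_chart_apply[OF p] ext_deriv_def[of L] Let_def by simp
  also have "\<dots> = 0"
    using c t p points_S unfolding closed_form_def by blast
  finally show "ext_deriv L (pullback L S \<phi> \<alpha>) p v w = 0" .
qed

text \<open>The differential of \<phi> maps onto the tangent space of the image: \<open>u\<close> is
  hit by the vector of \<open>L\<close> with the same coordinates.\<close>

lemma pullback_nonzero:
  assumes "p \<in> points L" "u \<in> tangent_space S (\<phi> p)" "\<alpha> (\<phi> p) u \<noteq> 0"
  shows "\<exists>v. pullback L S \<phi> \<alpha> p v \<noteq> 0"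
proof -
  let ?k = "chart_at L p"
  let ?v = "tangent_of L ?k p (u (\<iota> ?k))"
  have k: "?k \<in> charts_at L p"
    by (rule chart_at_in_charts_at[OF smooth_L assms(1)])
  have v: "?v \<in> tangent_space L p"
    by (rule tangent_of_in_tangent_space[OF smooth_L k])
  have "differential L S \<phi> p ?v = u"
    unfolding differential_to_image[OF k v] tangent_of_self[OF smooth_L k]
    by (rule tangent_of_coordinates[OF image_chart_in_charts_at[OF k] assms(2)])
  then have "pullback L S \<phi> \<alpha> p ?v \<noteq> 0"
    using assms v by (simp add: pullback_def)
  then show ?thesis
    by (intro exI[of _ ?v])
qed

end

section \<open>Contact forms and transversality\<close>

text \<open>Every summand of the contact volume contains \<alpha> evaluated on one vector of the
  frame, so a nonzero volume forces a nonzero value.\<close>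

lemma contact_form_on_nonzero:
  assumes "contact_form_on n M W \<alpha>" "p \<in> W" "n > 0"
  obtains v where "v \<in> tangent_space M p" "\<alpha> p v \<noteq> 0"
proof -
  obtain v where v: "\<And>i. i < 2 * n - 1 \<Longrightarrow> v i \<in> tangent_space M p"
    and nz: "contact_volume n M \<alpha> p v \<noteq> 0"
    using assms unfolding contact_form_on_def by blast
  have "\<exists>i < 2 * n - 1. \<alpha> p (v i) \<noteq> 0"
  proof (rule ccontr)
    assume "\<not> ?thesis"
    then have z: "\<alpha> p (v i) = 0" if "i < 2 * n - 1" for i
      using that by blast
    \<comment> \<open>With truncated subtraction, \<open>n > 0\<close> is what makes
      \<open>1 + 2 * (n - 1)\<close> equal to \<open>2 * n - 1\<close>, so that \<sigma> sends 0 to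
      an index of the frame.\<close>
    have "\<alpha> p (v (\<sigma> 0)) = 0" if "\<sigma> permutes {..<1 + 2 * (n - 1)}" for \<sigma>
      using permutes_in_image[OF that, of 0] assms(3) by (intro z) auto
    then have "contact_volume n M \<alpha> p v = 0"
      by (simp add: contact_volume_def wedge_def)
    with nz show False ..
  qed
  with v that show ?thesis
    by blast
qed

text \<open>\<alpha> vanishes on \<xi>; if it vanished on the tangent space of \<open>S\<close> too,
  it would vanish on their sum, the whole tangent space. The set \<open>W\<close> admits both a
  global contact form and a local one.\<close>

lemma transverse_contact_nonzero:
  assumes M: "smooth_manifold M" and S: "smooth_manifold S" and i: "smooth_map S M id"
    and tr: "transverse S M \<xi>" and q: "q \<in> points S" "q \<in> W"
    and a: "contact_form_on n M W \<alpha>" "n > 0" "\<xi> q = form_kernel M \<alpha> q"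
  obtains u where "u \<in> tangent_space S q" "\<alpha> q (differential S M id q u) \<noteq> 0"
proof -
  obtain t where t: "t \<in> tangent_space M q" "\<alpha> q t \<noteq> 0"
    using contact_form_on_nonzero[OF a(1) q(2) a(2)] by blast
  have "t \<in> {(\<lambda>\<kappa>. differential S M id q u \<kappa> + x \<kappa>) | u x. u \<in> tangent_space S q \<and> x \<in> \<xi> q}"
    using tr t(1) q(1) unfolding transverse_def by blast
  then obtain u x where u: "u \<in> tangent_space S q" and x: "x \<in> \<xi> q"
    and tux: "t = (\<lambda>\<kappa>. differential S M id q u \<kappa> + x \<kappa>)"
    by blast
  have x': "x \<in> tangent_space M q" "\<alpha> q x = 0"
    using x a(3) by (simp_all add: form_kernel_def)
  have d: "differential S M id q u \<in> tangent_space M q"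
    using differential_in_tangent_space[OF S M i q(1)] by simp
  have "\<alpha> q (\<lambda>\<kappa>. 1 *\<^sub>R differential S M id q u \<kappa> + 1 *\<^sub>R x \<kappa>) =
      1 * \<alpha> q (differential S M id q u) + 1 * \<alpha> q x"
    using a(1) q(2) d x'(1) unfolding contact_form_on_def one_form_on_def by blast
  then have "\<alpha> q (differential S M id q u) \<noteq> 0"
    using t(2) tux x'(2) by simp
  with u that show ?thesis
    by blast
qed

theorem theorem1p2:
  fixes U :: "('a, 'u::euclidean_space) manifold"
    and L :: "('b, 'l::euclidean_space) manifold"
    and n :: nat
    and \<xi> P :: "('a, 'u) distribution"
    and \<phi> :: "'b \<Rightarrow> 'a"
  assumes "DIM('u) = 2 * n - 1" and "DIM('l) = n"
    and "closed_manifold U"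
    and "contact_structure n U \<xi>" and "coorientation U \<xi> P"
    and "closed_manifold L"
    and "pre_Lagrangian_embedding L U \<xi> \<phi>"
  shows "(\<forall>\<alpha>. contact_form n U \<alpha> \<and> (\<forall>p\<in>points U. form_kernel U \<alpha> p = \<xi> p) \<and>
             closed_form L (pullback L U \<phi> \<alpha>) \<longrightarrow>
             deRham_class L (pullback L U \<phi> \<alpha>) \<noteq> \<one>\<^bsub>deRham_H1 L\<^esub>) \<and>
         carrier (deRham_H1 L) \<noteq> {\<one>\<^bsub>deRham_H1 L\<^esub>}"
proof -
  have n: "n > 0"
    using assms(2) DIM_positive[where 'a='l] by simp
  have U: "smooth_manifold U" and L: "smooth_manifold L"
    using assms(3,6) by (simp_all add: closed_manifold_def)
  have emb: "smooth_embedding L U \<phi>" and pre: "pre_Lagrangian (image_manifold L U \<phi>) U \<xi>"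
    using assms(7) by (simp_all add: pre_Lagrangian_embedding_def)
  have sub: "submanifold (image_manifold L U \<phi>) U" and tr: "transverse (image_manifold L U \<phi>) U \<xi>"
    using pre unfolding pre_Lagrangian_def by blast+
  have i: "smooth_map (image_manifold L U \<phi>) U id"
    using sub unfolding submanifold_def smooth_embedding_def by blast
  have cont: "continuous_map (mtop L) (mtop U) \<phi>"
    using emb unfolding smooth_embedding_def smooth_map_def by blast
  have inj: "inj_on \<phi> (points L)"
    using emb homeomorphic_imp_injective_map unfolding smooth_embedding_def embedding_map_def by blast
  interpret embedded_image L U \<phi>
    using L cont inj sub by unfold_locales (simp_all add: submanifold_def)
  note nz = transverse_contact_nonzero[OF U smooth_S i tr]
  have \<phi>U: "\<phi> p \<in> points U" and \<phi>S: "\<phi> p \<in> points S" if "p \<in> points L" for p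
    using that cont by (auto simp: points_S continuous_map_def)
  have "deRham_class L (pullback L U \<phi> \<alpha>) \<noteq> \<one>\<^bsub>deRham_H1 L\<^esub>"
    if a: "contact_form n U \<alpha>" "\<forall>p\<in>points U. form_kernel U \<alpha> p = \<xi> p" for \<alpha>
  proof (rule nowhere_zero_deRham_class_ne_one[OF assms(6)])
    fix p assume p: "p \<in> points L"
    obtain u where u: "u \<in> tangent_space S (\<phi> p)" "\<alpha> (\<phi> p) (differential S U id (\<phi> p) u) \<noteq> 0"
      using nz[OF \<phi>S[OF p] \<phi>U[OF p] a(1) n] a(2) \<phi>U[OF p] by metis
    \<comment> \<open>Transversality yields a vector of the image, whereas the pullback is evaluated
      on vectors of \<open>L\<close>.\<close>
    obtain v where "v \<in> tangent_space L p" "differential S U id (\<phi> p) u = differential L U \<phi> p v"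
      using differential_inclusion_image[OF i p u(1)] by blast
    then have "pullback L U \<phi> \<alpha> p v \<noteq> 0"
      using u p by (simp add: pullback_def)
    then show "\<exists>v. pullback L U \<phi> \<alpha> p v \<noteq> 0"
      by (intro exI[of _ v])
  qed
  moreover have "carrier (deRham_H1 L) \<noteq> {\<one>\<^bsub>deRham_H1 L\<^esub>}"
  proof -
    obtain \<beta> where b: "one_form S \<beta>" "closed_form S \<beta>"
      and ker: "\<And>q. q \<in> points S \<Longrightarrow> induced_distribution S U \<xi> q = form_kernel S \<beta> q"
      using pre unfolding pre_Lagrangian_def by blast
    have "\<exists>v. pullback L S \<phi> \<beta> p v \<noteq> 0" if p: "p \<in> points L" for p
    proof -
      have "\<exists>W \<alpha>. openin (mtop U) W \<and> \<phi> p \<in> W \<and> contact_form_on n U W \<alpha> \<and>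
          (\<forall>q\<in>W. \<xi> q = form_kernel U \<alpha> q)"
        using assms(4)[unfolded contact_structure_def] \<phi>U[OF p] by (rule bspec)
      \<comment> \<open>A local contact form suffices, since only \<xi> at the single point
        \<phi>(p) is at issue.\<close>
      then obtain W \<alpha> where W: "\<phi> p \<in> W" "contact_form_on n U W \<alpha>" "\<forall>q\<in>W. \<xi> q = form_kernel U \<alpha> q"
        by (elim exE conjE)
      note \<xi> = bspec[OF W(3,1)]
      obtain u where u: "u \<in> tangent_space S (\<phi> p)" "\<alpha> (\<phi> p) (differential S U id (\<phi> p) u) \<noteq> 0"
        using nz[OF \<phi>S[OF p] W(1,2) n \<xi>] by blast
      \<comment> \<open>A vector on which \<alpha> is nonzero lies outside \<xi>, hence outside the
        induced distribution, which is the kernel of \<beta>.\<close>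
      then have "u \<notin> form_kernel S \<beta> (\<phi> p)"
        unfolding ker[OF \<phi>S[OF p], symmetric] induced_distribution_def \<xi> by (simp add: form_kernel_def)
      with u(1) show ?thesis
        by (intro pullback_nonzero[OF p u(1)]) (simp add: form_kernel_def)
    qed
    then have "deRham_class L (pullback L S \<phi> \<beta>) \<noteq> \<one>\<^bsub>deRham_H1 L\<^esub>"
      by (rule nowhere_zero_deRham_class_ne_one[OF assms(6)])
    \<comment> \<open>Being a smooth closed form is what makes the pullback represent an element of
      the cohomology group.\<close>
    moreover have "deRham_class L (pullback L S \<phi> \<beta>) \<in> carrier (deRham_H1 L)"
      using one_form_pullback[OF b(1)] closed_form_pullback[OF b]
      by (auto simp: deRham_H1_def deRham_class_def carrier_FactGroup closed_forms_def)
    ultimately show ?thesis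
      by blast
  qed
  ultimately show ?thesis
    by blast
qed

end
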